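(* There exists a single-pass streaming algorithm for ELC-SNDP with edge weights $w:E\to\{0,1,\dots,W\}$ and maximum connectivity requirement $k$, in insertion-only streams, that uses $\tilde{O}\bigl(k^{1-1/t}\cdot n^{1+1/t}\bigr)$ space and outputs an $(8t)$-approximate solution.
   Context: ELC-SNDP (element-connectivity SNDP): the input is an undirected graph $G=(V,E)$ on $n$ vertices with edge weights, a set $R\subseteq V$ of reliable vertices (vertices in $V\setminus R$ are non-reliable), and integer requirements $r(uv)\ge0$ for pairs $u,v\in R$; elements are the edges and the non-reliable vertices. A set of $uv$-paths is element-disjoint if no two share an edge or a non-reliable vertex. The goal is a minimum-weight subgraph in which every pair $u,v\in R$ has $r(uv)$ element-disjoint paths; $k=\max r(uv)$. Insertion-only streaming model: edges arrive one by one in arbitrary order, one pass, space counted in words, computation time unrestricted. Standing assumptions: $W=n^{\mathrm{polylog}(n)}$, $t$ is a positive integer with $t=O(\log n)$, $\tilde O$ hides polylog$(n)$ factors. *)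

theory Defs
  imports Complex_Main "HOL-Library.Ramsey" "HOL-Library.FuncSet"
begin

section \<open>Element connectivity in simple undirected graphs\<close>

text \<open>Vertices are natural numbers; an edge is a two-element set of vertices, so that the edge set
  of a simple graph on \<open>V\<close> is a subset of \<open>[V]\<^bsup>2\<^esup>\<close>.\<close>

type_synonym edge = "nat set"

definition path_edges :: "nat list \<Rightarrow> edge set" where
  "path_edges p = {{p ! i, p ! Suc i} | i. Suc i < length p}"

definition is_path :: "edge set \<Rightarrow> nat \<Rightarrow> nat \<Rightarrow> nat list \<Rightarrow> bool" where
  "is_path F u v p \<longleftrightarrow>
     p \<noteq> [] \<and> hd p = u \<and> last p = v \<and> distinct p \<and> path_edges p \<subseteq> F"

text \<open>For paths of a graph on \<open>V\<close>, the vertices outside \<open>R\<close> are the non-reliable ones.\<close>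

definition element_disjoint :: "nat set \<Rightarrow> nat list set \<Rightarrow> bool" where
  "element_disjoint R P \<longleftrightarrow>
     (\<forall>p\<in>P. \<forall>q\<in>P. p \<noteq> q \<longrightarrow>
        path_edges p \<inter> path_edges q = {} \<and> (set p \<inter> set q) - R = {})"

definition has_element_disjoint_paths ::
    "nat set \<Rightarrow> edge set \<Rightarrow> nat \<Rightarrow> nat \<Rightarrow> nat \<Rightarrow> bool" where
  "has_element_disjoint_paths R F u v m \<longleftrightarrow>
     (\<exists>P. finite P \<and> card P = m \<and> (\<forall>p\<in>P. is_path F u v p) \<and> element_disjoint R P)"


section \<open>The problem ELC-SNDP\<close>

definition max_requirement :: "nat set \<Rightarrow> (nat set \<Rightarrow> nat) \<Rightarrow> nat" where
  "max_requirement R r = Max (insert 0 (r ` [R]\<^bsup>2\<^esup>))"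

definition elc_feasible ::
    "edge set \<Rightarrow> nat set \<Rightarrow> (nat set \<Rightarrow> nat) \<Rightarrow> edge set \<Rightarrow> bool" where
  "elc_feasible E R r F \<longleftrightarrow>
     F \<subseteq> E \<and>
     (\<forall>u\<in>R. \<forall>v\<in>R. u \<noteq> v \<longrightarrow> has_element_disjoint_paths R F u v (r {u, v}))"

definition elc_opt ::
    "edge set \<Rightarrow> (edge \<Rightarrow> nat) \<Rightarrow> nat set \<Rightarrow> (nat set \<Rightarrow> nat) \<Rightarrow> nat" where
  "elc_opt E w R r = Min (sum w ` {F. elc_feasible E R r F})"

definition elc_approximate ::
    "real \<Rightarrow> edge set \<Rightarrow> (edge \<Rightarrow> nat) \<Rightarrow> nat set \<Rightarrow> (nat set \<Rightarrow> nat) \<Rightarrow> edge set \<Rightarrow> bool" where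
  "elc_approximate \<alpha> E w R r F \<longleftrightarrow>
     elc_feasible E R r F \<and> real (sum w F) \<le> \<alpha> * real (elc_opt E w R r)"


section \<open>Single-pass streaming algorithms\<close>

text \<open>The memory is a list of words. The only information about the stream that survives
  from one item to the next, and that the output may use, is the content of the memory.
  Computation is unrestricted, so the transition and output maps are arbitrary functions.\<close>

record ('i, 'o) streaming_algorithm =
  initial :: "nat list"
  update :: "nat list \<Rightarrow> 'i \<Rightarrow> nat list"
  result :: "nat list \<Rightarrow> 'o"

definition memory_after :: "('i, 'o) streaming_algorithm \<Rightarrow> 'i list \<Rightarrow> nat list" where
  "memory_after A xs = foldl (update A) (initial A) xs"

definition output_on :: "('i, 'o) streaming_algorithm \<Rightarrow> 'i list \<Rightarrow> 'o" where
  "output_on A xs = result A (memory_after A xs)"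

text \<open>Words have \<open>log\<^sub>2 n\<close> bits, i.e. take values below \<open>n\<close>: a vertex name fits into one word,
  an edge weight has to be spread over several words in general.\<close>

definition uses_words :: "nat \<Rightarrow> ('i, 'o) streaming_algorithm \<Rightarrow> 'i list \<Rightarrow> bool" where
  "uses_words n A xs \<longleftrightarrow> (\<forall>i\<le>length xs. set (memory_after A (take i xs)) \<subseteq> {..<n})"

definition peak_space :: "('i, 'o) streaming_algorithm \<Rightarrow> 'i list \<Rightarrow> nat" where
  "peak_space A xs = Max ((\<lambda>i. length (memory_after A (take i xs))) ` {..length xs})"

text \<open>An algorithm for ELC-SNDP may depend on the part of the input that is not streamed,
  in this order: the number \<open>n\<close> of vertices (the vertex set is \<open>{..<n}\<close>), the reliable vertices,
  the requirements, the weight bound \<open>W\<close> and the trade-off parameter \<open>t\<close>.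
  The stream items are the edges together with their weights.\<close>

type_synonym elc_streaming_algorithm =
  "nat \<Rightarrow> nat set \<Rightarrow> (nat set \<Rightarrow> nat) \<Rightarrow> nat \<Rightarrow> nat \<Rightarrow> (edge \<times> nat, edge set) streaming_algorithm"

end

theory Submission imports Defs begin

text \<open>
  An arriving edge is stored unless the stored edges of its weight class (weights up to a factor 2)
  already contain \<open>2k\<close> internally disjoint paths with at most \<open>2t - 1\<close> edges between its ends.
  If it is stored, \<open>O(kt)\<close> vertices hit all these paths, so the stored edges of one class have the
  blocking sets of a vertex-fault-tolerant spanner, and sampling vertex subsets together with the Moore
  bound gives \<open>O(t k\<^bsup>1-1/t\<^esup> n\<^bsup>1+1/t\<^esup>)\<close> edges per class.

  The approximation guarantee does not use an LP relaxation. In an optimal solution \<open>F\<close> the edges that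
  were not stored are exchanged one at a time. The setpairs that become deficient when \<open>{u, v}\<close> is
  removed form a ring family by uncrossing. Hence the least cost of covering them is a shortest path
  distance, and it is at most the cost of the fractional cover that gives weight \<open>1/k\<close> to each of
  the \<open>2k\<close> disjoint short \<open>u\<close>-\<open>v\<close> paths: at most \<open>k\<close> of the paths are lost in a tight setpair, because
  its capacity is at most \<open>k\<close>. The exchange multiplies the weight by at most
  \<open>2 \<cdot> 2 \<cdot> 2t = 8t\<close>.
\<close>

section \<open>Menger's theorem\<close>

text \<open>The obstacle is that one replacement path for a discarded edge is not enough: in a
  setpair that has lost the edge, the path may run through an edge that the solution already owns,
  or through a vertex outside \<open>A \<union> B\<close>, and then it need not add capacity. A
  packing of size 2k leaves \<open>k\<close> useful paths in every tight setpair. Exchanging edges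
  one at a time is affordable because every added edge is a stored one: it is never exchanged again,
  and each discarded edge of the optimum pays once, in proportion to its own weight. In the space
  bound the factors of \<open>t\<close> and the number of weight classes are polylogarithmic, but
  the power of \<open>k\<close> has to be exact. A union of about \<open>k\<close> ordinary spanners
  would give the power 1; blocking sets are what lowers it to \<open>1 - 1 / t\<close>.\<close>

lemma walk_imp_distinct_walk:
  assumes "p \<noteq> []" "successively P p"
  shows "\<exists>q. q \<noteq> [] \<and> hd q = hd p \<and> last q = last p \<and> distinct q \<and> successively P q
     \<and> set q \<subseteq> set p \<and> length q \<le> length p"
  using assms
proof (induction "length p" arbitrary: p rule: less_induct)
  case less
  show ?case
  proof (cases "distinct p")
    case True
    then show ?thesis using less.prems by blast
  next
    case False
    then obtain xs ys zs y where p: "p = xs @ [y] @ ys @ [y] @ zs"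
      using not_distinct_decomp by blast
    let ?q = "xs @ [y] @ zs"
    have s: "successively P ?q"
      using less.prems(2) unfolding p by (auto simp: successively_append_iff successively_Cons)
    have "hd ?q = hd p" "last ?q = last p" "set ?q \<subseteq> set p" "length ?q < length p"
      unfolding p by (auto simp: hd_append)
    then show ?thesis using less.hyps[of ?q] s by (smt (verit) append_is_Nil_conv
        list.distinct(1) order.trans less_imp_le)
  qed
qed

definition walk_between :: "('a \<times> 'a) set \<Rightarrow> 'a set \<Rightarrow> 'a set \<Rightarrow> 'a list \<Rightarrow> bool" where
  "walk_between E A B p \<longleftrightarrow>
     p \<noteq> [] \<and> hd p \<in> A \<and> last p \<in> B \<and> successively (\<lambda>x y. (x, y) \<in> E) p"

definition separates :: "('a \<times> 'a) set \<Rightarrow> 'a set \<Rightarrow> 'a set \<Rightarrow> 'a set \<Rightarrow> bool" where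
  "separates E A B S \<longleftrightarrow> (\<forall>p. walk_between E A B p \<longrightarrow> set p \<inter> S \<noteq> {})"

lemma walk_between_mono: "walk_between E A B p \<Longrightarrow> E \<subseteq> E' \<Longrightarrow> walk_between E' A B p"
  unfolding walk_between_def by (auto elim: successively_mono)

lemma walk_between_distinct:
  assumes "walk_between E A B p"
  shows "\<exists>q. walk_between E A B q \<and> distinct q \<and> set q \<subseteq> set p"
  using walk_imp_distinct_walk[of p] assms unfolding walk_between_def by metis

lemma disjoint_walks_distinct:
  assumes "finite P" "\<forall>p\<in>P. walk_between E A B p" "pairwise (\<lambda>p q. set p \<inter> set q = {}) P"
  shows "\<exists>Q. finite Q \<and> card Q = card P \<and> (\<forall>p\<in>Q. walk_between E A B p \<and> distinct p)
     \<and> pairwise (\<lambda>p q. set p \<inter> set q = {}) Q"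
proof -
  have "\<forall>p\<in>P. \<exists>q. walk_between E A B q \<and> distinct q \<and> set q \<subseteq> set p"
    using assms(2) walk_between_distinct by blast
  then obtain g where g: "\<And>p. p \<in> P \<Longrightarrow> walk_between E A B (g p)"
    "\<And>p. p \<in> P \<Longrightarrow> distinct (g p)" "\<And>p. p \<in> P \<Longrightarrow> set (g p) \<subseteq> set p"
    by metis
  have dis: "set (g p) \<inter> set (g q) = {}" if "p \<in> P" "q \<in> P" "p \<noteq> q" for p q
  proof -
    have "set p \<inter> set q = {}" using assms(3) that by (simp add: pairwise_def)
    then show ?thesis using g(3)[OF that(1)] g(3)[OF that(2)] by blast
  qed
  have "inj_on g P"
  proof (rule inj_onI, rule ccontr)
    fix p q assume a: "p \<in> P" "q \<in> P" "g p = g q" "p \<noteq> q"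
    then have "set (g p) = {}" using dis by fastforce
    then show False using g(1)[OF a(1)] by (simp add: walk_between_def)
  qed
  moreover have "pairwise (\<lambda>p q. set p \<inter> set q = {}) (g ` P)"
    unfolding pairwise_def using dis by blast
  ultimately show ?thesis
    using g assms(1) by (intro exI[of _ "g ` P"]) (auto simp: card_image)
qed

text \<open>Goering's induction: delete an arc; if a separator gets too small, it can be completed by either
  end of the arc, and the walk systems on its two sides are glued along it.\<close>

theorem menger_vertex_sets:
  assumes "finite E" "finite A" "finite B"
    and "\<And>S. finite S \<Longrightarrow> separates E A B S \<Longrightarrow> k \<le> card S"
  shows "\<exists>P. finite P \<and> card P = k \<and> (\<forall>p\<in>P. walk_between E A B p)
     \<and> pairwise (\<lambda>p q. set p \<inter> set q = {}) P"
  using assms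
proof (induction E arbitrary: A B rule: finite_induct)
  case empty
  \<comment> \<open>Without arcs a walk is a single vertex, so one-vertex walks on
    \<open>A \<inter> B\<close> are the required system.\<close>
  have "separates {} A B (A \<inter> B)"
    unfolding separates_def walk_between_def
  proof (intro allI impI)
    fix p :: "'a list"
    assume "p \<noteq> [] \<and> hd p \<in> A \<and> last p \<in> B \<and> successively (\<lambda>x y. (x, y) \<in> {}) p"
    then show "set p \<inter> (A \<inter> B) \<noteq> {}" by (cases p) (auto simp: successively_Cons)
  qed
  then have "k \<le> card (A \<inter> B)" using empty by blast
  then obtain X where X: "X \<subseteq> A \<inter> B" "card X = k" "finite X"
    by (meson obtain_subset_with_card_n)
  let ?P = "(\<lambda>x. [x]) ` X"
  have "card ?P = k" using X by (subst card_image) (auto simp: inj_on_def)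
  then show ?case using X
    by (intro exI[of _ ?P]) (auto simp: walk_between_def pairwise_def)
next
  case (insert a E)
  obtain x y where a: "a = (x, y)" by (cases a)
  show ?case
  proof (cases "\<forall>S. finite S \<longrightarrow> separates E A B S \<longrightarrow> k \<le> card S")
    case True
    then obtain P where "finite P" "card P = k" "\<forall>p\<in>P. walk_between E A B p"
      "pairwise (\<lambda>p q. set p \<inter> set q = {}) P"
      using insert.IH[of A B] insert.prems by blast
    then show ?thesis
      by (intro exI[of _ P]) (auto intro: walk_between_mono[OF _ subset_insertI])
  next
    case False
    then obtain S where S: "finite S" "separates E A B S" "card S < k" by force
    have sepx: "separates (insert a E) A B (insert x S)"
      unfolding separates_def
    proof (intro allI impI notI)
      fix p assume p: "walk_between (insert a E) A B p" "set p \<inter> insert x S = {}"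
      then have "walk_between E A B p"
        unfolding walk_between_def a by (auto elim: successively_mono)
      then show False using S(2) p(2) by (auto simp: separates_def)
    qed
    have sepy: "separates (insert a E) A B (insert y S)"
      unfolding separates_def
    proof (intro allI impI notI)
      fix p assume p: "walk_between (insert a E) A B p" "set p \<inter> insert y S = {}"
      then have "walk_between E A B p"
        unfolding walk_between_def a by (auto elim: successively_mono)
      then show False using S(2) p(2) by (auto simp: separates_def)
    qed
    have kx: "k \<le> card (insert x S)" and ky: "k \<le> card (insert y S)"
      using insert.prems(3) sepx sepy S(1) by auto
    have xS: "x \<notin> S" and yS: "y \<notin> S"
      using kx ky S(3) by (auto simp: insert_absorb)
    have cx: "card (insert x S) = k" and cy: "card (insert y S) = k"
      using kx ky S xS yS by auto
    \<comment> \<open>Cut an \<open>A\<close>-\<open>B\<close> walk at its first vertex in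
      \<open>insert x S\<close>: the initial piece cannot use the arc \<open>a\<close>, which starts
      at \<open>x\<close>, so it is a walk of \<open>E\<close> and \<open>T\<close> meets it. Hence
      \<open>T\<close> separates \<open>A\<close> from \<open>B\<close> even with \<open>a\<close>
      present.\<close>
    have "k \<le> card T" if T: "finite T" "separates E A (insert x S) T" for T
    proof (rule insert.prems(3)[OF T(1)], unfold separates_def, intro allI impI)
      fix p assume p: "walk_between (insert a E) A B p"
      then have "\<exists>z\<in>set p. z \<in> insert x S" using sepx by (auto simp: separates_def)
      from split_list_first_prop[OF this] obtain p1 z p2 where dec: "p = p1 @ z # p2"
        "z \<in> insert x S" "\<forall>w\<in>set p1. w \<notin> insert x S" by blast
      have "successively (\<lambda>x y. (x, y) \<in> insert a E) p1"
        "p1 = [] \<or> (last p1, z) \<in> insert a E"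
        using p by (auto simp: walk_between_def dec successively_append_iff)
      moreover have "p1 = [] \<or> last p1 \<noteq> x" using dec(3) by (metis insertI1 last_in_set)
      ultimately have "successively (\<lambda>x y. (x, y) \<in> E) p1" "p1 = [] \<or> (last p1, z) \<in> E"
        using dec(3) unfolding a by (auto elim: successively_mono)
      then have "walk_between E A (insert x S) (p1 @ [z])"
        using p dec(2) unfolding walk_between_def dec(1)
        by (auto simp: successively_append_iff hd_append)
      then show "set p \<inter> T \<noteq> {}" using T(2) dec(1) by (fastforce simp: separates_def)
    qed
    then obtain P0 where P0: "finite P0" "card P0 = k" "\<forall>p\<in>P0. walk_between E A (insert x S) p"
      "pairwise (\<lambda>p q. set p \<inter> set q = {}) P0"
      using insert.IH[of A "insert x S"] insert.prems S(1) by blast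
    obtain P where P: "finite P" "card P = k"
      "\<And>p. p \<in> P \<Longrightarrow> walk_between E A (insert x S) p" "\<And>p. p \<in> P \<Longrightarrow> distinct p"
      "pairwise (\<lambda>p q. set p \<inter> set q = {}) P"
      using disjoint_walks_distinct[OF P0(1,3,4)] P0(2) by blast
    have "k \<le> card T" if T: "finite T" "separates E (insert y S) B T" for T
    proof (rule insert.prems(3)[OF T(1)], unfold separates_def, intro allI impI)
      fix p assume p: "walk_between (insert a E) A B p"
      then have "\<exists>z\<in>set p. z \<in> insert y S" using sepy by (auto simp: separates_def)
      from split_list_last_prop[OF this] obtain p1 z p2 where dec: "p = p1 @ z # p2"
        "z \<in> insert y S" "\<forall>w\<in>set p2. w \<notin> insert y S" by blast
      have "successively (\<lambda>x y. (x, y) \<in> insert a E) p2"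
        "p2 = [] \<or> (z, hd p2) \<in> insert a E"
        using p by (auto simp: walk_between_def dec successively_append_iff successively_Cons)
      moreover have "p2 = [] \<or> hd p2 \<noteq> y" using dec(3) by (metis insertI1 hd_in_set)
      ultimately have "successively (\<lambda>x y. (x, y) \<in> E) p2" "p2 = [] \<or> (z, hd p2) \<in> E"
        using dec(3) unfolding a by (auto elim: successively_mono)
      then have "walk_between E (insert y S) B (z # p2)"
        using p dec(2) unfolding walk_between_def dec(1)
        by (auto simp: successively_Cons)
      then show "set p \<inter> T \<noteq> {}" using T(2) dec(1) by (fastforce simp: separates_def)
    qed
    then obtain Q0 where Q0: "finite Q0" "card Q0 = k" "\<forall>p\<in>Q0. walk_between E (insert y S) B p"
      "pairwise (\<lambda>p q. set p \<inter> set q = {}) Q0"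
      using insert.IH[of "insert y S" B] insert.prems S(1) by blast
    obtain Q where Q: "finite Q" "card Q = k"
      "\<And>p. p \<in> Q \<Longrightarrow> walk_between E (insert y S) B p" "\<And>p. p \<in> Q \<Longrightarrow> distinct p"
      "pairwise (\<lambda>p q. set p \<inter> set q = {}) Q"
      using disjoint_walks_distinct[OF Q0(1,3,4)] Q0(2) by blast
    have Pdis: "p = p'" if "p \<in> P" "p' \<in> P" "v \<in> set p" "v \<in> set p'" for p p' v
      using P(5) that by (auto simp: pairwise_def)
    have Qdis: "p = p'" if "p \<in> Q" "p' \<in> Q" "v \<in> set p" "v \<in> set p'" for p p' v
      using Q(5) that by (auto simp: pairwise_def)
    have Pne: "p \<noteq> []" "hd p \<in> A" "last p \<in> insert x S" "last p \<in> set p"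
      "successively (\<lambda>x y. (x, y) \<in> E) p" if "p \<in> P" for p
      using P(3)[OF that] by (auto simp: walk_between_def)
    have Qne: "p \<noteq> []" "hd p \<in> insert y S" "last p \<in> B" "hd p \<in> set p"
      "successively (\<lambda>x y. (x, y) \<in> E) p" if "p \<in> Q" for p
      using Q(3)[OF that] by (auto simp: walk_between_def)
    have injP: "inj_on last P" by (rule inj_onI) (metis Pdis Pne(4))
    have injQ: "inj_on hd Q" by (rule inj_onI) (metis Qdis Qne(4))
    have imP: "last ` P = insert x S"
      by (rule card_subset_eq) (use Pne(3) S(1) cx P(2) injP in \<open>auto simp: card_image\<close>)
    have imQ: "hd ` Q = insert y S"
      by (rule card_subset_eq) (use Qne(2) S(1) cy Q(2) injQ in \<open>auto simp: card_image\<close>)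
    \<comment> \<open>Splicing \<open>p\<close> up to \<open>v\<close> with \<open>q\<close> from
      \<open>v\<close> on gives an \<open>A\<close>-\<open>B\<close> walk of \<open>E\<close>, which
      must meet \<open>S\<close>. Disjointness within \<open>P\<close> and within \<open>Q\<close>
      lets a walk meet \<open>S\<close> only at its last respectively first vertex, so the common
      vertex lies in \<open>S\<close> and is that end of both.\<close>
    have meet: "last p = hd q \<and> last p \<in> S" if pq: "p \<in> P" "q \<in> Q" "v \<in> set p" "v \<in> set q" for p q v
    proof -
      obtain p1 p2 where p: "p = p1 @ v # p2" using pq(3) split_list by fastforce
      obtain q1 q2 where q: "q = q1 @ v # q2" using pq(4) split_list by fastforce
      have "walk_between E A B (p1 @ v # q2)"
        using Pne(1,2,5)[OF pq(1)] Qne(3,5)[OF pq(2)] unfolding walk_between_def p q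
        by (auto simp: successively_append_iff hd_append)
      then obtain s where s: "s \<in> set (p1 @ v # q2)" "s \<in> S"
        using S(2) unfolding separates_def by blast
      have "v \<in> S"
      proof (cases "s \<in> set q2")
        case False
        then have "s \<in> set p" using s(1) p by auto
        moreover obtain p' where "p' \<in> P" "last p' = s" using imP s(2) by (metis imageE insertI2)
        ultimately have "last p = s" using Pdis Pne(4) pq(1) by metis
        moreover have "last p \<in> set (v # p2)" unfolding p by auto
        ultimately have "s \<notin> set p1" using P(4)[OF pq(1)] unfolding p by auto
        then show ?thesis using False s by auto
      next
        case True
        then have "s \<in> set q" using q by auto
        moreover obtain q' where "q' \<in> Q" "hd q' = s" using imQ s(2) by (metis imageE insertI2)
        ultimately have "hd q = s" using Qdis Qne(4) pq(2) by metis
        then have "s \<in> set (q1 @ [v])" unfolding q by (cases q1) auto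
        then show ?thesis using Q(4)[OF pq(2)] True unfolding q by auto
      qed
      obtain p' where "p' \<in> P" "last p' = v" using imP \<open>v \<in> S\<close> by (metis imageE insertI2)
      then have "last p = v" using Pdis Pne(4) pq by metis
      moreover obtain q' where "q' \<in> Q" "hd q' = v" using imQ \<open>v \<in> S\<close> by (metis imageE insertI2)
      then have "hd q = v" using Qdis Qne(4) pq by metis
      ultimately show ?thesis using \<open>v \<in> S\<close> by simp
    qed
    \<comment> \<open>\<open>\<sigma>\<close> matches the ends of \<open>P\<close> with the starts
      of \<open>Q\<close>: \<open>x\<close> with \<open>y\<close> along the deleted arc, every
      vertex of \<open>S\<close> with itself. It is injective on \<open>insert x S\<close> because
      \<open>y\<close> is not in \<open>S\<close>.\<close>
    define \<sigma> where "\<sigma> z = (if z = x then y else z)" for z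
    define g where "g p = inv_into Q hd (\<sigma> (last p))" for p
    have \<sigma>: "\<sigma> (last p) \<in> hd ` Q" if "p \<in> P" for p
      using Pne(3)[OF that] imQ by (auto simp: \<sigma>_def)
    have gQ: "g p \<in> Q" and ghd: "hd (g p) = \<sigma> (last p)" if "p \<in> P" for p
      unfolding g_def using \<sigma>[OF that] by (auto intro: inv_into_into f_inv_into_f)
    \<comment> \<open>Only the walk through \<open>a\<close> keeps the first vertex of its second
      half; elsewhere this vertex is the last one of \<open>p\<close> and would be repeated.\<close>
    define h where "h p = (if last p = x then p @ g p else p @ tl (g p))" for p
    have hset: "set (h p) \<subseteq> set p \<union> set (g p)" for p
      by (cases "g p") (auto simp: h_def)
    have hne: "h p \<noteq> []" if "p \<in> P" for p using Pne(1)[OF that] by (simp add: h_def)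
    have walk: "walk_between (insert a E) A B (h p)" if "p \<in> P" for p
    proof -
      note pn = Pne[OF that] and qn = Qne[OF gQ[OF that]]
      have sE: "successively (\<lambda>x y. (x, y) \<in> insert a E) p"
        "successively (\<lambda>x y. (x, y) \<in> insert a E) (g p)"
        using pn(5) qn(5) by (auto elim: successively_mono)
      obtain b q where bq: "g p = b # q" using qn(1) by (cases "g p") auto
      show ?thesis
      proof (cases "last p = x")
        case True
        then have "b = y" using ghd[OF that] bq by (simp add: \<sigma>_def)
        then show ?thesis using True pn qn(3) sE bq
          by (auto simp: walk_between_def h_def successively_append_iff a)
      next
        case False
        then have "b = last p" using ghd[OF that] bq by (simp add: \<sigma>_def)
        then show ?thesis using False pn qn(3) sE bq
          by (auto simp: walk_between_def h_def successively_append_iff successively_Cons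
              last_append)
      qed
    qed
    have cross: "p = p'" if "p \<in> P" "p' \<in> P" "v \<in> set p" "v \<in> set (g p')" for p p' v
    proof -
      have "last p = hd (g p')" "last p \<in> S" using meet that gQ by blast+
      then have "last p = \<sigma> (last p')" "last p \<in> S" using ghd that(2) by auto
      then have "last p = last p'" using yS by (auto simp: \<sigma>_def split: if_splits)
      then show ?thesis using injP that by (auto simp: inj_on_def)
    qed
    have ginj: "p = p'" if "p \<in> P" "p' \<in> P" "v \<in> set (g p)" "v \<in> set (g p')" for p p' v
    proof -
      have "g p = g p'" using Qdis gQ that by blast
      then have "\<sigma> (last p) = \<sigma> (last p')" using ghd that by metis
      moreover have "\<sigma> (last p) = y \<longleftrightarrow> last p = x" if "p \<in> P" for p
        using Pne(3)[OF that] yS by (auto simp: \<sigma>_def)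
      ultimately have "last p = last p'" using that(1,2) by (metis \<sigma>_def)
      then show ?thesis using injP that by (auto simp: inj_on_def)
    qed
    have hdis: "p = p'" if "p \<in> P" "p' \<in> P" "v \<in> set (h p)" "v \<in> set (h p')" for p p' v
      using hset[of p] hset[of p'] that Pdis cross ginj by blast
    have "inj_on h P" by (rule inj_onI) (metis hdis hne list.set_intros(1) neq_Nil_conv)
    then have "card (h ` P) = k" using P(2) by (simp add: card_image)
    moreover have "pairwise (\<lambda>p q. set p \<inter> set q = {}) (h ` P)"
      unfolding pairwise_def using hdis by blast
    ultimately show ?thesis using P(1) walk by (intro exI[of _ "h ` P"]) auto
  qed
qed

section \<open>Element cuts\<close>

lemma path_edges_subset_iff: "path_edges p \<subseteq> F \<longleftrightarrow> successively (\<lambda>x y. {x, y} \<in> F) p"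
  unfolding path_edges_def successively_conv_nth by auto

lemma path_edges_subset_set: "e \<in> path_edges p \<Longrightarrow> e \<subseteq> set p"
  by (auto simp: path_edges_def)

lemma is_path_iff:
  "is_path F u v p \<longleftrightarrow>
     p \<noteq> [] \<and> hd p = u \<and> last p = v \<and> distinct p \<and> successively (\<lambda>x y. {x, y} \<in> F) p"
  by (auto simp: is_path_def path_edges_subset_iff)

text \<open>The oriented form of \<open>path_edges\<close>. Covering a setpair needs the direction
  in which a path runs from \<open>A\<close> to \<open>B\<close>, which the undirected edge does not
  record.\<close>

definition arcs :: "nat list \<Rightarrow> (nat \<times> nat) set" where
  "arcs p = {(p ! i, p ! Suc i) | i. Suc i < length p}"

lemma path_edges_arcs: "path_edges p = (\<lambda>(x, y). {x, y}) ` arcs p"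
  by (auto simp: path_edges_def arcs_def)

lemma arcs_simps: "arcs [] = {}" "arcs [x] = {}" "arcs (x # y # p) = insert (x, y) (arcs (y # p))"
proof -
  show "arcs (x # y # p) = insert (x, y) (arcs (y # p))"
    unfolding arcs_def
  proof (intro equalityI subsetI)
    fix z assume "z \<in> {((x # y # p) ! i, (x # y # p) ! Suc i) |i. Suc i < length (x # y # p)}"
    then obtain i where i: "z = ((x # y # p) ! i, (x # y # p) ! Suc i)" "Suc i < length (x # y # p)"
      by blast
    then show "z \<in> insert (x, y) {((y # p) ! i, (y # p) ! Suc i) |i. Suc i < length (y # p)}"
      by (cases i) auto
  next
    fix z assume "z \<in> insert (x, y) {((y # p) ! i, (y # p) ! Suc i) |i. Suc i < length (y # p)}"
    then consider "z = (x, y)"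
      | i where "z = ((y # p) ! i, (y # p) ! Suc i)" "Suc i < length (y # p)" by blast
    then show "z \<in> {((x # y # p) ! i, (x # y # p) ! Suc i) |i. Suc i < length (x # y # p)}"
    proof cases
      case 1
      then show ?thesis by (auto intro!: exI[of _ 0])
    next
      case (2 i)
      then show ?thesis by (auto intro!: exI[of _ "Suc i"])
    qed
  qed
qed (auto simp: arcs_def)

lemma card_arcs_le: "card (arcs p) \<le> length p - 1" and finite_arcs: "finite (arcs p)"
proof -
  have eq: "arcs p = (\<lambda>i. (p ! i, p ! Suc i)) ` {..<length p - 1}"
    unfolding arcs_def by (auto simp: less_diff_conv)
  show "card (arcs p) \<le> length p - 1" unfolding eq
    by (metis card_image_le card_lessThan finite_lessThan)
  show "finite (arcs p)" unfolding eq by simp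
qed

lemma exists_crossing_arc:
  assumes "p \<noteq> []" "hd p \<in> A" "last p \<in> B" "set p \<subseteq> A \<union> B" "A \<inter> B = {}"
  shows "\<exists>(x, y) \<in> arcs p. x \<in> A \<and> y \<in> B"
  using assms
proof (induction p)
  case (Cons x p)
  show ?case
  proof (cases p)
    case Nil
    then show ?thesis using Cons.prems by auto
  next
    case (Cons y q)
    have a: "arcs (x # p) = insert (x, y) (arcs p)" by (simp add: Cons arcs_simps)
    show ?thesis
    proof (cases "y \<in> B")
      case True
      then show ?thesis using a Cons.prems by auto
    next
      case False
      then have "y \<in> A" using Cons.prems Cons by auto
      then show ?thesis using a Cons.IH Cons.prems Cons by auto
    qed
  qed
qed simp

definition crossing :: "edge set \<Rightarrow> nat set \<Rightarrow> nat set \<Rightarrow> edge set" where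
  "crossing F A B = {e \<in> F. e \<inter> A \<noteq> {} \<and> e \<inter> B \<noteq> {}}"

definition setpair :: "nat set \<Rightarrow> nat set \<Rightarrow> nat set \<Rightarrow> nat set \<Rightarrow> bool" where
  "setpair V R A B \<longleftrightarrow> A \<inter> B = {} \<and> A \<union> B \<subseteq> V \<and> R \<subseteq> A \<union> B"

text \<open>The capacity of the element cut that consists of the vertices outside \<open>A \<union> B\<close>
  and of the edges between \<open>A\<close> and \<open>B\<close>.\<close>

definition cut_size :: "nat set \<Rightarrow> edge set \<Rightarrow> nat set \<Rightarrow> nat set \<Rightarrow> nat" where
  "cut_size V F A B = card (crossing F A B) + card (V - (A \<union> B))"

text \<open>Each path picks an element that it meets, and different paths pick different elements.
  Disjointness is asked for on \<open>D\<close> and \<open>Z\<close> only, because element-disjoint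
  paths may share reliable vertices and packed paths share their ends.\<close>

lemma card_le_card_hit_elements:
  assumes "finite D" "finite Z"
    and hit: "\<And>p. p \<in> P \<Longrightarrow> path_edges p \<inter> D \<noteq> {} \<or> set p \<inter> Z \<noteq> {}"
    and dis: "\<And>p q. p \<in> P \<Longrightarrow> q \<in> P \<Longrightarrow> p \<noteq> q \<Longrightarrow>
      path_edges p \<inter> path_edges q \<inter> D = {} \<and> set p \<inter> set q \<inter> Z = {}"
  shows "card P \<le> card D + card Z"
proof -
  have "\<forall>p\<in>P. \<exists>z \<in> D <+> Z. (\<forall>e. z = Inl e \<longrightarrow> e \<in> path_edges p) \<and> (\<forall>x. z = Inr x \<longrightarrow> x \<in> set p)"
  proof
    fix p assume "p \<in> P"
    then consider e where "e \<in> path_edges p" "e \<in> D" | x where "x \<in> set p" "x \<in> Z"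
      using hit by blast
    then show "\<exists>z \<in> D <+> Z. (\<forall>e. z = Inl e \<longrightarrow> e \<in> path_edges p) \<and> (\<forall>x. z = Inr x \<longrightarrow> x \<in> set p)"
      by cases auto
  qed
  then obtain h where h: "\<And>p. p \<in> P \<Longrightarrow> h p \<in> D <+> Z"
    "\<And>p e. p \<in> P \<Longrightarrow> h p = Inl e \<Longrightarrow> e \<in> path_edges p"
    "\<And>p x. p \<in> P \<Longrightarrow> h p = Inr x \<Longrightarrow> x \<in> set p" by metis
  have "inj_on h P"
  proof (rule inj_onI, rule ccontr)
    fix p q assume pq: "p \<in> P" "q \<in> P" "h p = h q" "p \<noteq> q"
    from h(1)[OF pq(1)] show False
    proof (rule PlusE)
      fix e assume "e \<in> D" "h p = Inl e"
      then show False using h(2)[OF pq(1)] h(2)[OF pq(2)] pq dis by (metis IntI emptyE)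
    next
      fix x assume "x \<in> Z" "h p = Inr x"
      then show False using h(3)[OF pq(1)] h(3)[OF pq(2)] pq dis by (metis IntI emptyE)
    qed
  qed
  moreover have "h ` P \<subseteq> D <+> Z" using h(1) by blast
  ultimately have "card P \<le> card (D <+> Z)" using assms by (intro card_inj_on_le) auto
  then show ?thesis using assms by (simp add: card_Plus)
qed

lemma path_hits_cut:
  assumes "is_path F u v p" "u \<in> A" "v \<in> B" "A \<inter> B = {}" "set p \<subseteq> V"
  shows "path_edges p \<inter> crossing F A B \<noteq> {} \<or> set p \<inter> (V - (A \<union> B)) \<noteq> {}"
proof (rule disjCI)
  assume "\<not> set p \<inter> (V - (A \<union> B)) \<noteq> {}"
  then have "set p \<subseteq> A \<union> B" using assms(5) by auto
  then obtain x y where xy: "(x, y) \<in> arcs p" "x \<in> A" "y \<in> B"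
    using exists_crossing_arc[of p A B] assms by (auto simp: is_path_def)
  then have "{x, y} \<in> path_edges p" by (force simp: path_edges_arcs)
  moreover from this have "{x, y} \<in> crossing F A B"
    using xy assms(1) by (auto simp: crossing_def is_path_def)
  ultimately show "path_edges p \<inter> crossing F A B \<noteq> {}" by blast
qed

lemma is_path_vertices:
  assumes "is_path F u v p" "F \<subseteq> [V]\<^bsup>2\<^esup>" "u \<in> V"
  shows "set p \<subseteq> V"
proof -
  have "p \<noteq> [] \<Longrightarrow> hd p \<in> V \<Longrightarrow> successively (\<lambda>x y. {x, y} \<in> F) p \<Longrightarrow> set p \<subseteq> V" for p
    using assms(2) by (induction p) (fastforce simp: successively_Cons)+
  then show ?thesis using assms by (auto simp: is_path_iff)
qed

lemma element_disjoint_paths_le_cut: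
  assumes "has_element_disjoint_paths R F u v m" "finite V" "F \<subseteq> [V]\<^bsup>2\<^esup>"
    and "setpair V R A B" "u \<in> A" "v \<in> B"
  shows "m \<le> cut_size V F A B"
proof -
  obtain P where P: "card P = m" "\<forall>p\<in>P. is_path F u v p" "element_disjoint R P"
    using assms(1) by (auto simp: has_element_disjoint_paths_def)
  have "finite F" using assms(2,3) by (meson finite_imp_finite_nsets finite_subset)
  then have fin: "finite (crossing F A B)" by (simp add: crossing_def)
  have "card P \<le> card (crossing F A B) + card (V - (A \<union> B))"
  proof (rule card_le_card_hit_elements)
    fix p assume "p \<in> P"
    then have p: "is_path F u v p" using P(2) by blast
    show "path_edges p \<inter> crossing F A B \<noteq> {} \<or> set p \<inter> (V - (A \<union> B)) \<noteq> {}"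
      by (rule path_hits_cut[OF p])
        (use assms(4-6) is_path_vertices[OF p assms(3)] in \<open>auto simp: setpair_def\<close>)
  next
    fix p q assume "p \<in> P" "q \<in> P" "p \<noteq> q"
    then have "path_edges p \<inter> path_edges q = {} \<and> (set p \<inter> set q) - R = {}"
      using P(3) by (simp add: element_disjoint_def)
    then show "path_edges p \<inter> path_edges q \<inter> crossing F A B = {} \<and>
        set p \<inter> set q \<inter> (V - (A \<union> B)) = {}"
      using assms(4) by (auto simp: setpair_def)
  qed (use assms(2) fin in auto)
  then show ?thesis using P(1) by (simp add: cut_size_def)
qed

text \<open>Menger's theorem is applied to the graph whose nodes are the elements: two edges are adjacent
  if they share a reliable vertex, and a non-reliable vertex, represented by its singleton,
  is adjacent to its incident edges.\<close>

lemma element_menger: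
  assumes V: "finite V" "F \<subseteq> [V]\<^bsup>2\<^esup>" "R \<subseteq> V" and uv: "u \<in> R" "v \<in> R" "u \<noteq> v"
    and cut: "\<And>A B. setpair V R A B \<Longrightarrow> u \<in> A \<Longrightarrow> v \<in> B \<Longrightarrow> m \<le> cut_size V F A B"
  shows "has_element_disjoint_paths R F u v m"
proof -
  define N where "N = F \<union> (\<lambda>x. {x}) ` (V - R)"
  \<comment> \<open>Two different edges that share only a non-reliable vertex are not adjacent; a
    walk has to pass through the singleton of this vertex and so uses it up. A reliable vertex has
    no node of its own and can be shared by disjoint walks.\<close>
  define D where "D = {(X, Y) \<in> N \<times> N. \<exists>z \<in> X \<inter> Y. z \<in> R \<or> X = {z} \<or> Y = {z}}"
  define A where "A = {e \<in> F. u \<in> e}"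
  define B where "B = {e \<in> F. v \<in> e}"
  have finF: "finite F" using V by (meson finite_imp_finite_nsets finite_subset)
  have finN: "finite N" unfolding N_def using finF V by auto
  have finD: "finite D" unfolding D_def
    by (rule finite_subset[of _ "N \<times> N"]) (use finN in auto)
  have F2: "\<exists>x y. e = {x, y} \<and> x \<noteq> y \<and> x \<in> V \<and> y \<in> V" if "e \<in> F" for e
    using that V(2) by (meson nsets2_E subsetD)
  have single: "{x} \<notin> F" for x using F2 by fastforce
  have "m \<le> card S" if S: "finite S" "separates D A B S" for S
  proof -
    define Z where "Z = {x \<in> V - R. {x} \<in> S}"
    define rel where "rel = {(x, y). {x, y} \<in> F - S \<and> x \<notin> Z \<and> y \<notin> Z}"
    \<comment> \<open>A separator \<open>S\<close> of the element graph becomes a setpair: on one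
      side the vertices that \<open>u\<close> reaches without using \<open>S\<close>, on the other
      the remaining vertices outside \<open>Z\<close>.\<close>
    define T where "T = {x. (u, x) \<in> rel\<^sup>*}"
    have uZ: "u \<notin> Z" using uv by (auto simp: Z_def)
    have TV: "T \<subseteq> V - Z"
    proof
      fix x assume "x \<in> T"
      then have "(u, x) \<in> rel\<^sup>*" by (simp add: T_def)
      then show "x \<in> V - Z"
      proof (induction rule: rtrancl_induct)
        case base
        then show ?case using uZ uv V by auto
      next
        case (step y z)
        then show ?case using V(2) by (auto simp: rel_def)
      qed
    qed
    have reach: "x = u \<or> (\<exists>p. p \<noteq> [] \<and> hd p \<in> A \<and> successively (\<lambda>X Y. (X, Y) \<in> D) p \<and> set p \<inter> S = {}
        \<and> x \<in> last p \<and> last p \<in> F)"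
      if "(u, x) \<in> rel\<^sup>*" for x
      using that
    proof (induction rule: rtrancl_induct)
      case (step y z)
      have e: "{y, z} \<in> F" "{y, z} \<notin> S" "y \<notin> Z" using step.hyps by (auto simp: rel_def)
      from step.IH show ?case
      proof
        assume "y = u"
        then show ?thesis using e by (intro disjI2 exI[of _ "[{y, z}]"]) (auto simp: A_def)
      next
        assume "\<exists>p. p \<noteq> [] \<and> hd p \<in> A \<and> successively (\<lambda>X Y. (X, Y) \<in> D) p \<and> set p \<inter> S = {}
          \<and> y \<in> last p \<and> last p \<in> F"
        then obtain p where p: "p \<noteq> []" "hd p \<in> A" "successively (\<lambda>X Y. (X, Y) \<in> D) p"
          "set p \<inter> S = {}" "y \<in> last p" "last p \<in> F" by blast
        have yV: "y \<in> V" using e(1) V(2) by auto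
        show ?thesis
        proof (cases "y \<in> R")
          case True
          then have "(last p, {y, z}) \<in> D" using p e by (auto simp: D_def N_def)
          then show ?thesis using p e
            by (intro disjI2 exI[of _ "p @ [{y, z}]"]) (auto simp: successively_append_iff)
        next
          case False
          then have "(last p, {y}) \<in> D" "({y}, {y, z}) \<in> D" "{y} \<notin> S"
            using p e yV by (auto simp: D_def N_def Z_def)
          then show ?thesis using p e
            by (intro disjI2 exI[of _ "p @ [{y}, {y, z}]"]) (auto simp: successively_append_iff)
        qed
      qed
    qed simp
    have vT: "v \<notin> T"
    proof
      assume "v \<in> T"
      then obtain p where "p \<noteq> []" "hd p \<in> A" "successively (\<lambda>X Y. (X, Y) \<in> D) p" "set p \<inter> S = {}"
        "v \<in> last p" "last p \<in> F"
        using reach[of v] uv by (auto simp: T_def)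
      then have "walk_between D A B p" by (auto simp: walk_between_def B_def)
      then show False using S(2) \<open>set p \<inter> S = {}\<close> by (auto simp: separates_def)
    qed
    let ?B = "V - Z - T"
    have sp: "setpair V R T ?B" using TV V(3) by (auto simp: setpair_def Z_def)
    have cr: "crossing F T ?B \<subseteq> S"
    proof
      fix e assume e: "e \<in> crossing F T ?B"
      then obtain x y where xy: "x \<in> T" "y \<in> ?B" "x \<in> e" "y \<in> e" "e \<in> F" by (auto simp: crossing_def)
      then have "e = {x, y}" using F2[of e] by auto
      show "e \<in> S"
      proof (rule ccontr)
        assume "e \<notin> S"
        then have "(x, y) \<in> rel" using xy \<open>e = {x, y}\<close> TV by (auto simp: rel_def)
        then have "y \<in> T" using xy(1) by (auto simp: T_def intro: rtrancl_into_rtrancl)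
        then show False using xy by auto
      qed
    qed
    have ZS: "(\<lambda>x. {x}) ` Z \<subseteq> S" by (auto simp: Z_def)
    have "m \<le> cut_size V F T ?B" using cut[OF sp] vT uv V by (auto simp: T_def Z_def)
    also have "V - (T \<union> ?B) = Z" using TV by (auto simp: Z_def)
    then have "cut_size V F T ?B = card (crossing F T ?B) + card Z" by (simp add: cut_size_def)
    also have "card Z = card ((\<lambda>x. {x}) ` Z)" by (simp add: card_image inj_on_def)
    \<comment> \<open>The two kinds of elements can be added up inside \<open>S\<close> because no
      edge of \<open>F\<close> is a singleton.\<close>
    also have "card (crossing F T ?B) + card ((\<lambda>x. {x}) ` Z) =
        card (crossing F T ?B \<union> (\<lambda>x. {x}) ` Z)"
      using single S(1) cr ZS
      by (intro card_Un_disjoint[symmetric]) (auto simp: crossing_def intro: finite_subset)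
    also have "\<dots> \<le> card S" using S(1) cr ZS by (intro card_mono) auto
    finally show ?thesis .
  qed
  then obtain P where P: "finite P" "card P = m" "\<And>p. p \<in> P \<Longrightarrow> walk_between D A B p"
    "pairwise (\<lambda>p q. set p \<inter> set q = {}) P"
    using menger_vertex_sets[of D A B m] finD finF by (auto simp: A_def B_def)
  \<comment> \<open>Conversely, a walk of elements contains a path whose edges are nodes of the walk
    and whose non-reliable vertices have their singletons on it; disjoint walks therefore give
    element-disjoint paths.\<close>
  have "\<exists>q. is_path F u v q \<and> path_edges q \<subseteq> set p \<and> (\<forall>x\<in>set q - R. {x} \<in> set p)" if "p \<in> P" for p
  proof -
    note w = P(3)[OF that, unfolded walk_between_def]
    define M where "M = R \<union> {x. {x} \<in> set p}"
    define rel where "rel = {(x, y). {x, y} \<in> F \<inter> set p \<and> x \<in> M \<and> y \<in> M}"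
    \<comment> \<open>Moving along an adjacency keeps the invariant: the shared vertex
      \<open>z\<close> is admissible, and if it differs from the vertex already reached in the same
      node, then that node is an edge and joins the two.\<close>
    have main: "\<forall>X \<in> set xs. X \<in> N \<and> (\<exists>x\<in>X. x \<in> M \<and> (u, x) \<in> rel\<^sup>*)"
      if "xs \<noteq> []" "hd xs \<in> A" "successively (\<lambda>X Y. (X, Y) \<in> D) xs" "set xs \<subseteq> set p" for xs
      using that
    proof (induction xs rule: rev_induct)
      case (snoc Y xs)
      show ?case
      proof (cases "xs = []")
        case True
        then have "Y \<in> A" using snoc by simp
        then have "u \<in> Y" "Y \<in> N" by (auto simp: A_def N_def)
        then show ?thesis using True uv by (auto simp: M_def)
      next
        case False
        then have IH: "\<forall>X \<in> set xs. X \<in> N \<and> (\<exists>x\<in>X. x \<in> M \<and> (u, x) \<in> rel\<^sup>*)"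
          using snoc by (auto simp: successively_append_iff)
        have D: "(last xs, Y) \<in> D" using snoc False by (auto simp: successively_append_iff)
        have mem: "last xs \<in> set p" "Y \<in> set p" using snoc.prems False by auto
        obtain z where z: "z \<in> last xs" "z \<in> Y" "z \<in> R \<or> last xs = {z} \<or> Y = {z}"
          and N: "last xs \<in> N" "Y \<in> N" using D by (auto simp: D_def)
        have zM: "z \<in> M" using z mem by (auto simp: M_def)
        obtain x where x: "x \<in> last xs" "x \<in> M" "(u, x) \<in> rel\<^sup>*"
          using IH False last_in_set by blast
        have "(u, z) \<in> rel\<^sup>*"
        proof (cases "x = z")
          case False
          then have "last xs \<in> F" using x z N by (auto simp: N_def)
          then have "last xs = {x, z}" using F2[of "last xs"] x z False by auto
          then have "(x, z) \<in> rel" using \<open>last xs \<in> F\<close> mem x zM by (auto simp: rel_def)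
          then show ?thesis using x by (meson rtrancl_into_rtrancl)
        qed (use x in simp)
        then show ?thesis using IH N z zM by auto
      qed
    qed simp
    have "last p \<in> B" "last p \<in> set p" using w by auto
    then obtain x where x: "x \<in> last p" "x \<in> M" "(u, x) \<in> rel\<^sup>*"
      using main[of p] w by blast
    have vM: "v \<in> M" using uv by (simp add: M_def)
    have "(u, v) \<in> rel\<^sup>*"
    proof (cases "x = v")
      case False
      then have "last p = {x, v}" using F2[of "last p"] x \<open>last p \<in> B\<close> by (auto simp: B_def)
      then have "(x, v) \<in> rel" using \<open>last p \<in> B\<close> \<open>last p \<in> set p\<close> x vM by (auto simp: rel_def B_def)
      then show ?thesis using x by (meson rtrancl_into_rtrancl)
    qed (use x in simp)
    then have "\<exists>q. q \<noteq> [] \<and> hd q = u \<and> last q = v \<and> successively (\<lambda>x y. (x, y) \<in> rel) q \<and> set q \<subseteq> M"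
    proof (induction rule: rtrancl_induct)
      case base
      then show ?case using uv by (intro exI[of _ "[u]"]) (auto simp: M_def)
    next
      case (step y z)
      then obtain q where "q \<noteq> []" "hd q = u" "last q = y" "successively (\<lambda>x y. (x, y) \<in> rel) q" "set q \<subseteq> M"
        by blast
      then show ?case using step.hyps
        by (intro exI[of _ "q @ [z]"]) (auto simp: successively_append_iff rel_def)
    qed
    then obtain q0 where q0: "q0 \<noteq> []" "hd q0 = u" "last q0 = v"
      "successively (\<lambda>x y. (x, y) \<in> rel) q0" "set q0 \<subseteq> M" by blast
    then obtain q where q: "q \<noteq> []" "hd q = u" "last q = v" "distinct q"
      "successively (\<lambda>x y. (x, y) \<in> rel) q" "set q \<subseteq> M"
      using walk_imp_distinct_walk[OF q0(1,4)] by auto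
    have "successively (\<lambda>x y. {x, y} \<in> F \<inter> set p) q"
      using q(5) by (rule successively_mono) (auto simp: rel_def)
    then have "path_edges q \<subseteq> F \<inter> set p" by (subst path_edges_subset_iff)
    then show ?thesis using q by (intro exI[of _ q]) (auto simp: is_path_def M_def)
  qed
  then obtain g where g: "\<And>p. p \<in> P \<Longrightarrow> is_path F u v (g p)"
    "\<And>p. p \<in> P \<Longrightarrow> path_edges (g p) \<subseteq> set p"
    "\<And>p x. p \<in> P \<Longrightarrow> x \<in> set (g p) - R \<Longrightarrow> {x} \<in> set p" by metis
  have Pdis: "set p \<inter> set q = {}" if "p \<in> P" "q \<in> P" "p \<noteq> q" for p q
    using P(4) that by (simp add: pairwise_def)
  \<comment> \<open>Since \<open>u \<noteq> v\<close> every path has an edge, so the paths of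
    disjoint walks are distinct.\<close>
  have ne: "path_edges (g p) \<noteq> {}" if p: "p \<in> P" for p
  proof -
    have a: "g p \<noteq> []" "hd (g p) = u" "last (g p) = v" using g(1)[OF p] by (auto simp: is_path_def)
    then obtain x y q where "g p = x # y # q" using uv(3)
      by (cases "g p"; cases "tl (g p)") auto
    then show ?thesis by (simp add: path_edges_arcs arcs_simps)
  qed
  have inj: "inj_on g P"
  proof (rule inj_onI, rule ccontr)
    fix p q assume a: "p \<in> P" "q \<in> P" "g p = g q" "p \<noteq> q"
    then have "path_edges (g p) \<subseteq> set p \<inter> set q" using g(2) by (metis Int_subset_iff)
    then show False using ne[OF a(1)] Pdis[OF a(1,2,4)] by auto
  qed
  have "element_disjoint R (g ` P)"
    unfolding element_disjoint_def
  proof (intro ballI impI)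
    fix a b assume "a \<in> g ` P" "b \<in> g ` P" "a \<noteq> b"
    then obtain p q where pq: "p \<in> P" "q \<in> P" "p \<noteq> q" "a = g p" "b = g q" by blast
    have "path_edges a \<inter> path_edges b \<subseteq> set p \<inter> set q" using g(2) pq by blast
    moreover have "{x} \<in> set p \<inter> set q" if "x \<in> (set a \<inter> set b) - R" for x
      using g(3) that pq by blast
    ultimately show "path_edges a \<inter> path_edges b = {} \<and> (set a \<inter> set b) - R = {}"
      using Pdis[OF pq(1-3)] by blast
  qed
  moreover have "card (g ` P) = m" using inj P(2) by (simp add: card_image)
  ultimately show ?thesis unfolding has_element_disjoint_paths_def
    using P(1) g(1) by (intro exI[of _ "g ` P"]) auto
qed

section \<open>Covering ring families\<close>

lemma ring_family_Union_Inter: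
  assumes "finite K" "K \<noteq> {}" "K \<subseteq> L"
    and "\<And>X Y. X \<in> L \<Longrightarrow> Y \<in> L \<Longrightarrow> X \<union> Y \<in> L" "\<And>X Y. X \<in> L \<Longrightarrow> Y \<in> L \<Longrightarrow> X \<inter> Y \<in> L"
  shows "\<Union>K \<in> L" "\<Inter>K \<in> L"
  using assms(1-3) by (induction K rule: finite_ne_induct) (use assms(4,5) in auto)

text \<open>Let the distance of a point \<open>p\<close> be the least cost of a set of arcs that covers the members
  of the family avoiding \<open>p\<close>. Sublevel sets of the distance belong to the family, and an arc \<open>j\<close>
  leaves at most \<open>c j\<close> of them.\<close>

lemma ring_family_cover:
  fixes L :: "'b set set" and J :: "'j set" and tail head :: "'j \<Rightarrow> 'b" and c :: "'j \<Rightarrow> nat"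
  assumes fin: "finite L" "finite J" and m: "m > 0"
    and Un: "\<And>X Y. X \<in> L \<Longrightarrow> Y \<in> L \<Longrightarrow> X \<union> Y \<in> L"
    and Int: "\<And>X Y. X \<in> L \<Longrightarrow> Y \<in> L \<Longrightarrow> X \<inter> Y \<in> L"
    and s: "\<And>X. X \<in> L \<Longrightarrow> s \<in> X" and z: "\<And>X. X \<in> L \<Longrightarrow> z \<notin> X"
    and leave: "\<And>X. X \<in> L \<Longrightarrow> m \<le> card {j \<in> J. tail j \<in> X \<and> head j \<notin> X}"
  shows "\<exists>Q \<subseteq> J. (\<forall>X\<in>L. \<exists>j\<in>Q. tail j \<in> X \<and> head j \<notin> X) \<and> m * sum c Q \<le> sum c J"
proof -
  define cov where
    "cov Q p \<longleftrightarrow> Q \<subseteq> J \<and> (\<forall>X\<in>L. p \<notin> X \<longrightarrow> (\<exists>j\<in>Q. tail j \<in> X \<and> head j \<notin> X))" for Q p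
  define lev where "lev \<theta> = {p. \<exists>Q. cov Q p \<and> sum c Q \<le> \<theta>}" for \<theta>
  have "cov J z"
    unfolding cov_def
  proof (intro conjI ballI impI subset_refl)
    fix X assume "X \<in> L"
    then have "{j \<in> J. tail j \<in> X \<and> head j \<notin> X} \<noteq> {}"
      using leave m by (metis card.empty not_le)
    then show "\<exists>j\<in>J. tail j \<in> X \<and> head j \<notin> X" by blast
  qed
  then have ex: "\<exists>d. \<exists>Q. cov Q z \<and> sum c Q = d" by blast
  define D where "D = (LEAST d. \<exists>Q. cov Q z \<and> sum c Q = d)"
  obtain Q where Q: "cov Q z" "sum c Q = D" using LeastI_ex[OF ex] by (auto simp: D_def)
  have zlev: "z \<notin> lev \<theta>" if "\<theta> < D" for \<theta>
  proof
    assume "z \<in> lev \<theta>"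
    then obtain Q' where "cov Q' z" "sum c Q' \<le> \<theta>" by (auto simp: lev_def)
    then have "D \<le> sum c Q'" unfolding D_def by (blast intro: Least_le)
    then show False using that \<open>sum c Q' \<le> \<theta>\<close> by simp
  qed
  \<comment> \<open>\<open>lev \<theta>\<close> is the union of the least members \<open>M p\<close>
    around its points: a member that avoids a point \<open>q\<close> of \<open>M p\<close> also
    avoids \<open>p\<close>, so a cover that is good for \<open>p\<close> is good for
    \<open>q\<close>. The point \<open>s\<close> keeps this union from being empty.\<close>
  have levL: "lev \<theta> \<in> L" if \<theta>: "\<theta> < D" for \<theta>
  proof -
    define M :: "'b \<Rightarrow> 'b set" where "M p = \<Inter>{X \<in> L. p \<in> X}" for p
    \<comment> \<open>If no member contained \<open>p\<close>, every member would avoid it and the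
      cheap cover for \<open>p\<close> would cover the whole family, against
      \<open>\<theta> < D\<close>.\<close>
    have ne: "{X \<in> L. p \<in> X} \<noteq> {}" if p: "p \<in> lev \<theta>" for p
    proof
      assume "{X \<in> L. p \<in> X} = {}"
      then have "z \<in> lev \<theta>" using p by (auto simp: lev_def cov_def)
      then show False using zlev \<theta> by blast
    qed
    have Mmem: "M p \<in> L" if "p \<in> lev \<theta>" for p
      unfolding M_def by (rule ring_family_Union_Inter(2)) (use ne[OF that] fin Un Int in auto)
    have Msub: "M p \<subseteq> lev \<theta>" if p: "p \<in> lev \<theta>" for p
    proof
      fix q assume q: "q \<in> M p"
      obtain Q where Q: "cov Q p" "sum c Q \<le> \<theta>" using p by (auto simp: lev_def)
      then have "cov Q q" using q by (auto simp: cov_def M_def)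
      then show "q \<in> lev \<theta>" using Q by (auto simp: lev_def)
    qed
    have "p \<in> M p" for p by (auto simp: M_def)
    then have eq: "lev \<theta> = \<Union>(M ` lev \<theta>)" using Msub by blast
    have "cov {} s" using s by (auto simp: cov_def)
    then have "s \<in> lev \<theta>" unfolding lev_def by force
    then have "\<Union>(M ` lev \<theta>) \<in> L"
      by (intro ring_family_Union_Inter(1)) (use Mmem fin Un Int in \<open>auto intro: finite_subset\<close>)
    then show ?thesis using eq by simp
  qed
  \<comment> \<open>A member that avoids \<open>head j\<close> either avoids \<open>tail j\<close>
    too or is left by \<open>j\<close> itself.\<close>
  have step: "head j \<in> lev (\<theta> + c j)" if j: "j \<in> J" "tail j \<in> lev \<theta>" for j \<theta>
  proof -
    obtain Q where Q: "cov Q (tail j)" "sum c Q \<le> \<theta>" using j(2) by (auto simp: lev_def)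
    have "finite Q" using Q(1) fin by (auto simp: cov_def intro: finite_subset)
    then have "sum c (insert j Q) \<le> \<theta> + c j" using Q(2) by (simp add: sum.insert_if)
    moreover have "cov (insert j Q) (head j)" using Q(1) j(1) by (auto simp: cov_def)
    ultimately show ?thesis by (auto simp: lev_def)
  qed
  have mono: "lev \<theta> \<subseteq> lev \<theta>'" if "\<theta> \<le> \<theta>'" for \<theta> \<theta>' using that by (force simp: lev_def)
  define out where "out \<theta> j \<longleftrightarrow> tail j \<in> lev \<theta> \<and> head j \<notin> lev \<theta>" for \<theta> j
  \<comment> \<open>The levels that \<open>j\<close> leaves start at the distance
    \<open>\<alpha>\<close> of its tail and end before \<open>\<alpha> + c j\<close>.\<close>
  have out_card: "card {\<theta> \<in> {..<D}. out \<theta> j} \<le> c j" if "j \<in> J" for j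
  proof (cases "\<exists>\<theta>. tail j \<in> lev \<theta>")
    case False
    then show ?thesis by (simp add: out_def)
  next
    case True
    define \<alpha> where "\<alpha> = (LEAST \<theta>. tail j \<in> lev \<theta>)"
    have "tail j \<in> lev \<alpha>" using LeastI_ex[OF True] by (simp add: \<alpha>_def)
    then have "head j \<in> lev (\<alpha> + c j)" using step that by blast
    then have "\<alpha> \<le> \<theta> \<and> \<theta> < \<alpha> + c j" if "out \<theta> j" for \<theta>
      using that mono[of "\<alpha> + c j" \<theta>] Least_le[of "\<lambda>\<theta>. tail j \<in> lev \<theta>" \<theta>]
      by (force simp: out_def \<alpha>_def)
    then have "{\<theta> \<in> {..<D}. out \<theta> j} \<subseteq> {\<alpha>..<\<alpha> + c j}" by auto
    then have "card {\<theta> \<in> {..<D}. out \<theta> j} \<le> card {\<alpha>..<\<alpha> + c j}" by (intro card_mono) auto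
    then show ?thesis by simp
  qed
  have ce: "card {x \<in> S. P x} = (\<Sum>x\<in>S. if P x then 1 else 0)" if "finite S" for S :: "'x set" and P
    using that by (simp add: sum.If_cases Int_def)
  \<comment> \<open>Double counting of the pairs of a level below \<open>D\<close> and an arc that
    leaves it.\<close>
  have "m * D = (\<Sum>\<theta><D. m)" by simp
  also have "\<dots> \<le> (\<Sum>\<theta><D. card {j \<in> J. out \<theta> j})"
    using leave[OF levL] by (intro sum_mono) (auto simp: out_def)
  also have "\<dots> = (\<Sum>\<theta><D. \<Sum>j\<in>J. if out \<theta> j then 1 else 0)" using fin by (simp add: ce)
  also have "\<dots> = (\<Sum>j\<in>J. \<Sum>\<theta><D. if out \<theta> j then 1 else 0)" by (rule sum.swap)
  also have "\<dots> = (\<Sum>j\<in>J. card {\<theta> \<in> {..<D}. out \<theta> j})" 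
    by (intro sum.cong refl ce[symmetric]) simp
  also have "\<dots> \<le> sum c J" using out_card by (intro sum_mono)
  finally show ?thesis using Q z by (intro exI[of _ Q]) (auto simp: cov_def)
qed

section \<open>Exchanging an edge\<close>

definition cut_feasible :: "nat set \<Rightarrow> nat set \<Rightarrow> (nat set \<Rightarrow> nat) \<Rightarrow> edge set \<Rightarrow> bool" where
  "cut_feasible V R r F \<longleftrightarrow>
     (\<forall>A B. \<forall>a \<in> A \<inter> R. \<forall>b \<in> B \<inter> R. setpair V R A B \<longrightarrow> r {a, b} \<le> cut_size V F A B)"

text \<open>Menger's theorem in both directions. It lets the exchange argument treat feasibility as
  a condition on setpairs, without the paths of a solution.\<close>

lemma elc_feasible_iff_cut_feasible:
  assumes "finite V" "E \<subseteq> [V]\<^bsup>2\<^esup>" "R \<subseteq> V" "F \<subseteq> E"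
  shows "elc_feasible E R r F \<longleftrightarrow> cut_feasible V R r F"
proof
  have F: "F \<subseteq> [V]\<^bsup>2\<^esup>" using assms by auto
  show "cut_feasible V R r F" if "elc_feasible E R r F"
    unfolding cut_feasible_def
  proof (intro allI ballI impI)
    fix A B a b assume a: "a \<in> A \<inter> R" "b \<in> B \<inter> R" "setpair V R A B"
    then have "a \<noteq> b" by (auto simp: setpair_def)
    then have "has_element_disjoint_paths R F a b (r {a, b})"
      using that a by (auto simp: elc_feasible_def)
    then show "r {a, b} \<le> cut_size V F A B"
      using element_disjoint_paths_le_cut[OF _ assms(1) F a(3)] a by blast
  qed
  show "elc_feasible E R r F" if "cut_feasible V R r F"
    unfolding elc_feasible_def
  proof (intro conjI ballI impI assms)
    fix u v assume "u \<in> R" "v \<in> R" "u \<noteq> v"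
    then show "has_element_disjoint_paths R F u v (r {u, v})"
      using that by (intro element_menger[OF assms(1) F assms(3)]) (auto simp: cut_feasible_def)
  qed
qed

section \<open>Submodularity of element cuts and uncrossing of tight setpairs\<close>

lemma cut_size_commute: "cut_size V F A B = cut_size V F B A"
proof -
  have "crossing F A B = crossing F B A" by (auto simp: crossing_def)
  then show ?thesis by (simp add: cut_size_def Un_commute)
qed

lemma setpair_commute: "setpair V R A B \<Longrightarrow> setpair V R B A"
  by (auto simp: setpair_def)

lemma setpair_disjoint: "setpair V R A B \<Longrightarrow> x \<in> A \<Longrightarrow> x \<notin> B"
  by (auto simp: setpair_def)

lemma setpair_uncross:
  assumes "setpair V R A B" "setpair V R A' B'"
  shows "setpair V R (A \<inter> A') (B \<union> B')" "setpair V R (A \<union> A') (B \<inter> B')"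
  using assms by (auto simp: setpair_def)

text \<open>The inequality holds separately for every edge and every vertex: each is counted by a
  0-1 function of the positions of its ends relative to the two setpairs, and the finitely many
  positions are checked.\<close>

lemma cut_size_submodular:
  assumes V: "finite V" "F \<subseteq> [V]\<^bsup>2\<^esup>" and AB: "setpair V R A B" "setpair V R A' B'"
  shows "cut_size V F (A \<inter> A') (B \<union> B') + cut_size V F (A \<union> A') (B \<inter> B')
    \<le> cut_size V F A B + cut_size V F A' B'"
proof -
  have finF: "finite F" using V by (meson finite_imp_finite_nsets finite_subset)
  define x where "x A B e = (if e \<inter> A \<noteq> {} \<and> e \<inter> B \<noteq> {} then 1 else 0::nat)" for A B e :: "nat set"
  define y where "y A B v = (if v \<notin> A \<and> v \<notin> B then 1 else 0::nat)" for A B and v :: nat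
  have cs: "cut_size V F A B = (\<Sum>e\<in>F. x A B e) + (\<Sum>v\<in>V. y A B v)" for A B
    using finF V(1) unfolding cut_size_def x_def y_def crossing_def
    by (simp add: sum.If_cases Int_def set_diff_eq)
  have "x (A \<inter> A') (B \<union> B') e + x (A \<union> A') (B \<inter> B') e \<le> x A B e + x A' B' e" if eF: "e \<in> F" for e
  proof -
    obtain a b where e: "e = {a, b}" using eF V(2) by (meson nsets2_E subsetD)
    have meet: "{a, b} \<inter> X \<noteq> {} \<longleftrightarrow> a \<in> X \<or> b \<in> X" for X by auto
    have "a \<in> A \<Longrightarrow> a \<notin> B" "a \<in> A' \<Longrightarrow> a \<notin> B'" "b \<in> A \<Longrightarrow> b \<notin> B" "b \<in> A' \<Longrightarrow> b \<notin> B'"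
      using AB[THEN setpair_disjoint] by blast+
    then show ?thesis unfolding e x_def meet
      by (cases "a \<in> A"; cases "a \<in> A'"; cases "b \<in> A"; cases "b \<in> A'"; simp)
  qed
  then have 1: "(\<Sum>e\<in>F. x (A \<inter> A') (B \<union> B') e + x (A \<union> A') (B \<inter> B') e)
      \<le> (\<Sum>e\<in>F. x A B e + x A' B' e)" by (intro sum_mono)
  have "y (A \<inter> A') (B \<union> B') v + y (A \<union> A') (B \<inter> B') v \<le> y A B v + y A' B' v" for v
  proof -
    have "v \<in> A \<Longrightarrow> v \<notin> B" "v \<in> A' \<Longrightarrow> v \<notin> B'"
      using AB[THEN setpair_disjoint] by blast+
    then show ?thesis unfolding y_def by (cases "v \<in> A"; cases "v \<in> A'"; simp)
  qed
  then have 2: "(\<Sum>v\<in>V. y (A \<inter> A') (B \<union> B') v + y (A \<union> A') (B \<inter> B') v)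
      \<le> (\<Sum>v\<in>V. y A B v + y A' B' v)" by (intro sum_mono)
  show ?thesis using 1 2 by (simp add: cs sum.distrib)
qed

text \<open>For a feasible \<open>F\<close> these are the setpairs that become deficient when one
  crossing edge is removed. By feasibility the pair that attains equality has the largest
  requirement among the separated ones.\<close>

definition tight :: "nat set \<Rightarrow> nat set \<Rightarrow> (nat set \<Rightarrow> nat) \<Rightarrow> edge set \<Rightarrow> nat set \<Rightarrow> nat set \<Rightarrow> bool" where
  "tight V R r F A B \<longleftrightarrow>
     setpair V R A B \<and> (\<exists>a \<in> A \<inter> R. \<exists>b \<in> B \<inter> R. r {a, b} = cut_size V F A B)"

lemma cut_size_remove_edge:
  assumes "finite F" "{u, v} \<in> F" "u \<in> A" "v \<in> B"
  shows "cut_size V F A B = Suc (cut_size V (F - {{u, v}}) A B)"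
proof -
  have "crossing F A B = insert {u, v} (crossing (F - {{u, v}}) A B)"
    using assms by (auto simp: crossing_def)
  moreover have "finite (crossing (F - {{u, v}}) A B)" "{u, v} \<notin> crossing (F - {{u, v}}) A B"
    using assms by (auto simp: crossing_def)
  ultimately show ?thesis by (simp add: cut_size_def)
qed

lemma cut_size_mono:
  assumes "finite F'" "F \<subseteq> F'"
  shows "cut_size V F A B \<le> cut_size V F' A B"
  unfolding cut_size_def crossing_def using assms by (intro add_right_mono card_mono) auto

text \<open>The requirement function is weakly supermodular: one of the two ways of uncrossing works.
  The second one is excluded because the edge \<open>{u, v}\<close> crosses both setpairs but neither of their
  twisted combinations, so that submodularity is strict there.\<close>

lemma tight_uncross:
  assumes V: "finite V" "F \<subseteq> [V]\<^bsup>2\<^esup>" and feas: "cut_feasible V R r F" and e: "{u, v} \<in> F"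
    and AB: "tight V R r F A B" "u \<in> A" "v \<in> B"
    and AB': "tight V R r F A' B'" "u \<in> A'" "v \<in> B'"
  shows "tight V R r F (A \<inter> A') (B \<union> B')" "tight V R r F (A \<union> A') (B \<inter> B')"
proof -
  have finF: "finite F" using V by (meson finite_imp_finite_nsets finite_subset)
  have sp: "setpair V R A B" "setpair V R A' B'" "setpair V R B' A'"
    using AB AB' setpair_commute by (auto simp: tight_def)
  obtain a b where ab: "a \<in> A" "a \<in> R" "b \<in> B" "b \<in> R" "r {a, b} = cut_size V F A B"
    using AB by (auto simp: tight_def)
  obtain a' b' where ab': "a' \<in> A'" "a' \<in> R" "b' \<in> B'" "b' \<in> R" "r {a', b'} = cut_size V F A' B'"
    using AB' by (auto simp: tight_def)
  define N where "N = r {a, b}"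
  define N' where "N' = r {a', b'}"
  define D where "D X Y m \<longleftrightarrow> (\<exists>x \<in> X \<inter> R. \<exists>y \<in> Y \<inter> R. m = r {x, y})" for X Y m
  have DI: "D X Y (r {x, y})" if "x \<in> X" "x \<in> R" "y \<in> Y" "y \<in> R" for X Y x y
    using that by (auto simp: D_def)
  have DI2: "D X Y (r {x, y})" if "y \<in> X" "x \<in> R" "x \<in> Y" "y \<in> R" for X Y x y
    using DI[of y X x Y] that by (simp add: insert_commute)
  \<comment> \<open>\<open>D1\<close> and \<open>D2\<close> belong to the two straight combinations,
    \<open>D3\<close> and \<open>D4\<close> to the twisted ones, in which \<open>A'\<close> and
    \<open>B'\<close> change roles. Each holds for the requirements of reliable pairs that its
    combination separates.\<close>
  define D1 where "D1 = D (A \<inter> A') (B \<union> B')"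
  define D2 where "D2 = D (A \<union> A') (B \<inter> B')"
  define D3 where "D3 = D (A \<inter> B') (B \<union> A')"
  define D4 where "D4 = D (A \<union> B') (B \<inter> A')"
  note Ds = D1_def D2_def D3_def D4_def
  have R: "x \<in> A \<or> x \<in> B" "x \<in> A' \<or> x \<in> B'" if "x \<in> R" for x
    using sp that by (auto simp: setpair_def)
  have 1: "D1 N \<and> D2 N \<or> D1 N \<and> D4 N \<or> D2 N \<and> D3 N \<or> D3 N \<and> D4 N"
    using R(2)[OF ab(2)] R(2)[OF ab(4)]
  proof (elim disjE)
    assume "a \<in> A'" "b \<in> A'"
    then have "D1 N" "D4 N" unfolding Ds N_def using ab(1-4) by (auto intro: DI)
    then show ?thesis by blast
  next
    assume "a \<in> A'" "b \<in> B'"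
    then have "D1 N" "D2 N" unfolding Ds N_def using ab(1-4) by (auto intro: DI)
    then show ?thesis by blast
  next
    assume "a \<in> B'" "b \<in> A'"
    then have "D3 N" "D4 N" unfolding Ds N_def using ab(1-4) by (auto intro: DI)
    then show ?thesis by blast
  next
    assume "a \<in> B'" "b \<in> B'"
    then have "D2 N" "D3 N" unfolding Ds N_def using ab(1-4) by (auto intro: DI)
    then show ?thesis by blast
  qed
  have 2: "D1 N' \<and> D2 N' \<or> D1 N' \<and> D3 N' \<or> D2 N' \<and> D4 N' \<or> D3 N' \<and> D4 N'"
    using R(1)[OF ab'(2)] R(1)[OF ab'(4)]
  proof (elim disjE)
    assume "a' \<in> A" "b' \<in> A"
    then have "D1 N'" "D3 N'" unfolding Ds N'_def using ab'(1-4) by (auto intro: DI DI2)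
    then show ?thesis by blast
  next
    assume "a' \<in> A" "b' \<in> B"
    then have "D1 N'" "D2 N'" unfolding Ds N'_def using ab'(1-4) by (auto intro: DI DI2)
    then show ?thesis by blast
  next
    assume "a' \<in> B" "b' \<in> A"
    then have "D3 N'" "D4 N'" unfolding Ds N'_def using ab'(1-4) by (auto intro: DI DI2)
    then show ?thesis by blast
  next
    assume "a' \<in> B" "b' \<in> B"
    then have "D2 N'" "D4 N'" unfolding Ds N'_def using ab'(1-4) by (auto intro: DI DI2)
    then show ?thesis by blast
  qed
  have cutD: "m \<le> cut_size V F X Y" if "D X Y m" "setpair V R X Y" for X Y m
    using that feas by (auto simp: D_def cut_feasible_def)
  have c34: False if d: "D3 m" "D4 m'" "N + N' \<le> m + m'" for m m'
  proof -
    let ?F = "F - {{u, v}}"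
    have nc: "cut_size V ?F (A \<inter> B') (B \<union> A') = cut_size V F (A \<inter> B') (B \<union> A')"
      "cut_size V ?F (A \<union> B') (B \<inter> A') = cut_size V F (A \<union> B') (B \<inter> A')"
      using AB(2,3) AB'(2,3) sp
      by (auto simp: cut_size_def crossing_def setpair_def intro!: arg_cong[where f = card])
    have "cut_size V ?F (A \<inter> B') (B \<union> A') + cut_size V ?F (A \<union> B') (B \<inter> A')
        \<le> cut_size V ?F A B + cut_size V ?F B' A'"
      by (rule cut_size_submodular[OF V(1) _ sp(1,3)]) (use V in auto)
    moreover have "cut_size V ?F B' A' = cut_size V ?F A' B'" by (rule cut_size_commute)
    moreover have "Suc (cut_size V ?F A B) = N" "Suc (cut_size V ?F A' B') = N'"
      using cut_size_remove_edge[OF finF e, of _ _ V] AB AB' ab ab' by (auto simp: N_def N'_def)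
    moreover have "m \<le> cut_size V F (A \<inter> B') (B \<union> A')" "m' \<le> cut_size V F (A \<union> B') (B \<inter> A')"
      using cutD d(1,2) setpair_uncross[OF sp(1,3)] unfolding Ds by blast+
    ultimately show False using nc d(3) by linarith
  qed
  have "tight V R r F (A \<inter> A') (B \<union> B') \<and> tight V R r F (A \<union> A') (B \<inter> B')"
    if d: "D1 m" "D2 m'" "N + N' \<le> m + m'" for m m'
  proof -
    have s: "setpair V R (A \<inter> A') (B \<union> B')" "setpair V R (A \<union> A') (B \<inter> B')"
      using setpair_uncross[OF sp(1,2)] .
    have "m \<le> cut_size V F (A \<inter> A') (B \<union> B')" "m' \<le> cut_size V F (A \<union> A') (B \<inter> B')"
      using cutD d(1,2) s unfolding Ds by blast+
    moreover have "cut_size V F (A \<inter> A') (B \<union> B') + cut_size V F (A \<union> A') (B \<inter> B') \<le> N + N'"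
      using cut_size_submodular[OF V sp(1,2)] ab ab' by (simp add: N_def N'_def)
    ultimately have "m = cut_size V F (A \<inter> A') (B \<union> B')" "m' = cut_size V F (A \<union> A') (B \<inter> B')"
      using d(3) by linarith+
    then show ?thesis using d(1,2) s unfolding tight_def Ds D_def by metis
  qed
  \<comment> \<open>In every case of \<open>1\<close> and \<open>2\<close>, either \<open>D1\<close>
    and \<open>D2\<close> or \<open>D3\<close> and \<open>D4\<close> can be served with total at
    least \<open>N + N'\<close>: one value each, or the larger value twice. \<open>c34\<close> rules
    out the twisted alternative.\<close>
  then have "tight V R r F (A \<inter> A') (B \<union> B') \<and> tight V R r F (A \<union> A') (B \<inter> B')"
    using 1 2 c34 by (smt (verit, best) add.commute add_le_mono le_refl nat_le_linear)
  then show "tight V R r F (A \<inter> A') (B \<union> B')" "tight V R r F (A \<union> A') (B \<inter> B')" by auto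
qed

text \<open>The bound \<open>2 * T\<close> is the total cost \<open>2 * k * T\<close> of the packing
  divided by the \<open>k\<close> new arcs that cross each tight setpair from the side of
  \<open>u\<close> to that of \<open>v\<close>. The assumption \<open>{u, v} \<notin> H\<close>
  turns internal disjointness of the paths into edge-disjointness.\<close>

lemma exchange_edge:
  fixes w :: "edge \<Rightarrow> nat"
  assumes V: "finite V" "F \<subseteq> [V]\<^bsup>2\<^esup>" and H: "H \<subseteq> [V]\<^bsup>2\<^esup>" and feas: "cut_feasible V R r F"
    and k: "k > 0" "\<And>a b. a \<in> R \<Longrightarrow> b \<in> R \<Longrightarrow> a \<noteq> b \<Longrightarrow> r {a, b} \<le> k"
    and e: "{u, v} \<in> F" "{u, v} \<notin> H" "u \<noteq> v"
    and P: "finite P" "card P = 2 * k" "\<And>p. p \<in> P \<Longrightarrow> is_path H u v p"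
      "\<And>p. p \<in> P \<Longrightarrow> (\<Sum>(x, y)\<in>arcs p. w {x, y}) \<le> T"
      "\<And>p q. p \<in> P \<Longrightarrow> q \<in> P \<Longrightarrow> p \<noteq> q \<Longrightarrow> set p \<inter> set q \<subseteq> {u, v}"
  shows "\<exists>Q \<subseteq> H. cut_feasible V R r ((F - {{u, v}}) \<union> Q) \<and> sum w Q \<le> 2 * T"
proof -
  have finF: "finite F" and finH: "finite H"
    using V(1,2) H by (meson finite_imp_finite_nsets finite_subset)+
  have uvV: "u \<in> V" "v \<in> V" using e V by auto
  \<comment> \<open>A setpair becomes the set \<open>A\<close> in one copy of the vertices together
    with the complement of \<open>B\<close> in a second copy. Uncrossing is then plain intersection
    and union, and for \<open>y\<close> in \<open>V\<close> the arc from \<open>Inl x\<close> to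
    \<open>Inr y\<close> leaves the set exactly if \<open>x \<in> A\<close> and
    \<open>y \<in> B\<close>.\<close>
  define enc where "enc = (\<lambda>(A, B). Inl ` A \<union> Inr ` (V - B) :: (nat + nat) set)"
  define K where "K = {(A, B). tight V R r F A B \<and> u \<in> A \<and> v \<in> B}"
  \<comment> \<open>Only edges outside \<open>F\<close> raise a capacity when they are
    added.\<close>
  define J where "J = {(x, y). \<exists>p\<in>P. (x, y) \<in> arcs p \<and> {x, y} \<notin> F}"
  define c where "c = (\<lambda>(x, y). w {x, y})"
  have arcH: "{x, y} \<in> H" "x \<in> V" "y \<in> V" "x \<in> set p" "y \<in> set p" "{x, y} \<in> path_edges p"
    if "p \<in> P" "(x, y) \<in> arcs p" for p x y
  proof -
    show pe: "{x, y} \<in> path_edges p" using that by (force simp: path_edges_arcs)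
    then show "{x, y} \<in> H" using P(3)[OF that(1)] by (auto simp: is_path_def)
    then show "x \<in> V" "y \<in> V" using H by auto
    show "x \<in> set p" "y \<in> set p" using path_edges_subset_set[OF pe] by auto
  qed
  have edis: "path_edges p \<inter> path_edges q = {}" if pq: "p \<in> P" "q \<in> P" "p \<noteq> q" for p q
  proof (rule ccontr)
    assume "path_edges p \<inter> path_edges q \<noteq> {}"
    then obtain g where g: "g \<in> path_edges p" "g \<in> path_edges q" by blast
    then have "g \<in> H" using P(3)[OF pq(1)] by (auto simp: is_path_def)
    moreover have "g \<subseteq> {u, v}" using g path_edges_subset_set P(5)[OF pq] by blast
    moreover obtain x y where "g = {x, y}" "x \<noteq> y" using \<open>g \<in> H\<close> H by (meson nsets2_E subsetD)
    ultimately have "g = {u, v}" by auto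
    then show False using e(2) \<open>g \<in> H\<close> by simp
  qed
  have finK: "finite K"
    by (rule finite_subset[of _ "Pow V \<times> Pow V"])
      (use V in \<open>auto simp: K_def tight_def setpair_def\<close>)
  have Jsub: "J \<subseteq> (\<Union>p\<in>P. arcs p)" by (auto simp: J_def)
  have finJ: "finite J" by (rule finite_subset[OF Jsub]) (use P(1) finite_arcs in auto)
  have "\<exists>Q\<subseteq>J. (\<forall>X\<in>enc ` K. \<exists>j\<in>Q. Inl (fst j) \<in> X \<and> Inr (snd j) \<notin> X) \<and> k * sum c Q \<le> sum c J"
  proof (rule ring_family_cover[where s = "Inl u" and z = "Inr v"])
    fix X Y assume "X \<in> enc ` K" "Y \<in> enc ` K"
    then obtain A B A' B' where AB: "(A, B) \<in> K" "X = enc (A, B)" "(A', B') \<in> K" "Y = enc (A', B')"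
      by auto
    have "(A \<inter> A', B \<union> B') \<in> K" "(A \<union> A', B \<inter> B') \<in> K"
      using AB tight_uncross[OF V feas e(1)] by (auto simp: K_def)
    moreover have "X \<union> Y = enc (A \<union> A', B \<inter> B')" "X \<inter> Y = enc (A \<inter> A', B \<union> B')"
      using AB by (auto simp: enc_def)
    ultimately show "X \<union> Y \<in> enc ` K" "X \<inter> Y \<in> enc ` K" by (metis imageI)+
  next
    fix X assume "X \<in> enc ` K"
    then obtain A B where AB: "(A, B) \<in> K" "X = enc (A, B)" by auto
    then show "Inl u \<in> X" "Inr v \<notin> X" by (auto simp: K_def enc_def)
    have sp: "setpair V R A B" "u \<in> A" "v \<in> B" using AB by (auto simp: K_def tight_def)
    obtain a b where "a \<in> A \<inter> R" "b \<in> B \<inter> R" "r {a, b} = cut_size V F A B"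
      using AB by (auto simp: K_def tight_def)
    then have cutk: "cut_size V F A B \<le> k" using k(2)[of a b] sp by (auto simp: setpair_def)
    define Bad where
      "Bad = {p \<in> P. path_edges p \<inter> crossing F A B \<noteq> {} \<or> set p \<inter> (V - (A \<union> B)) \<noteq> {}}"
    have "card Bad \<le> card (crossing F A B) + card (V - (A \<union> B))"
    proof (rule card_le_card_hit_elements)
      fix p q assume "p \<in> Bad" "q \<in> Bad" "p \<noteq> q"
      then have "path_edges p \<inter> path_edges q = {}" "set p \<inter> set q \<subseteq> {u, v}"
        using edis P(5) unfolding Bad_def by blast+
      then show "path_edges p \<inter> path_edges q \<inter> crossing F A B = {} \<and>
          set p \<inter> set q \<inter> (V - (A \<union> B)) = {}"
        using sp(2,3) by blast
    next
      show "finite (crossing F A B)" "finite (V - (A \<union> B))"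
        using V(1) finF by (simp_all add: crossing_def)
      show "path_edges p \<inter> crossing F A B \<noteq> {} \<or> set p \<inter> (V - (A \<union> B)) \<noteq> {}" if "p \<in> Bad" for p
        using that unfolding Bad_def by blast
    qed
    then have "card Bad \<le> k" using cutk by (simp add: cut_size_def)
    moreover have "card (P - Bad) = card P - card Bad"
      using P(1) by (intro card_Diff_subset) (auto simp: Bad_def)
    ultimately have good: "k \<le> card (P - Bad)" using P(2) by simp
    \<comment> \<open>A path that is not bad stays inside \<open>A \<union> B\<close>, so it has an
      arc from \<open>A\<close> to \<open>B\<close>; this arc is new because the path avoids
      \<open>crossing F A B\<close>.\<close>
    have "\<exists>j. j \<in> arcs p \<and> j \<in> J \<and> Inl (fst j) \<in> X \<and> Inr (snd j) \<notin> X" if p: "p \<in> P - Bad" for p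
    proof -
      have pth: "is_path H u v p" using P(3) p by blast
      have "set p \<subseteq> A \<union> B" using is_path_vertices[OF pth H uvV(1)] p by (auto simp: Bad_def)
      then obtain x y where xy: "(x, y) \<in> arcs p" "x \<in> A" "y \<in> B"
        using exists_crossing_arc[of p A B] pth sp by (auto simp: is_path_def setpair_def)
      have "{x, y} \<in> path_edges p" using arcH(6) p xy(1) by blast
      then have "{x, y} \<notin> crossing F A B" using p unfolding Bad_def by blast
      then have "{x, y} \<notin> F" using xy unfolding crossing_def by blast
      then show ?thesis using xy p AB(2) by (intro exI[of _ "(x, y)"]) (auto simp: J_def enc_def)
    qed
    then have "\<forall>p \<in> P - Bad. \<exists>j. j \<in> arcs p \<and> j \<in> {j \<in> J. Inl (fst j) \<in> X \<and> Inr (snd j) \<notin> X}"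
      by blast
    from bchoice[OF this] obtain g where g: "\<And>p. p \<in> P - Bad \<Longrightarrow> g p \<in> arcs p"
      "\<And>p. p \<in> P - Bad \<Longrightarrow> g p \<in> {j \<in> J. Inl (fst j) \<in> X \<and> Inr (snd j) \<notin> X}" by blast
    have "inj_on g (P - Bad)"
    proof (rule inj_onI, rule ccontr)
      fix p q assume pq: "p \<in> P - Bad" "q \<in> P - Bad" "g p = g q" "p \<noteq> q"
      obtain x y where "g p = (x, y)" by (cases "g p")
      then have "{x, y} \<in> path_edges p \<inter> path_edges q"
        using g(1)[OF pq(1)] g(1)[OF pq(2)] pq arcH(6)[of p x y] arcH(6)[of q x y] by simp
      then show False using edis pq by blast
    qed
    moreover have "g ` (P - Bad) \<subseteq> {j \<in> J. Inl (fst j) \<in> X \<and> Inr (snd j) \<notin> X}" using g(2) by blast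
    ultimately have "card (P - Bad) \<le> card {j \<in> J. Inl (fst j) \<in> X \<and> Inr (snd j) \<notin> X}"
      by (rule card_inj_on_le) (simp add: finJ)
    then show "k \<le> card {j \<in> J. Inl (fst j) \<in> X \<and> Inr (snd j) \<notin> X}" using good by linarith
  qed (simp_all add: finK finJ k(1))
  then obtain Q0 where Q0: "Q0 \<subseteq> J" "\<forall>X \<in> enc ` K. \<exists>j\<in>Q0. Inl (fst j) \<in> X \<and> Inr (snd j) \<notin> X"
    "k * sum c Q0 \<le> sum c J" by (elim exE conjE) (rule that)
  have "sum c J \<le> sum c (\<Union>p\<in>P. arcs p)"
    by (rule sum_mono2[OF _ Jsub]) (simp_all add: P(1) finite_arcs)
  also have "\<dots> = (\<Sum>p\<in>P. sum c (arcs p))"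
  proof (rule sum.UNION_disjoint)
    show "\<forall>p\<in>P. \<forall>q\<in>P. p \<noteq> q \<longrightarrow> arcs p \<inter> arcs q = {}"
    proof (intro ballI impI equals0I)
      fix p q j assume pq: "p \<in> P" "q \<in> P" "p \<noteq> q" and "j \<in> arcs p \<inter> arcs q"
      moreover obtain x y where "j = (x, y)" by (cases j)
      ultimately have "{x, y} \<in> path_edges p \<inter> path_edges q"
        using arcH(6)[of p x y] arcH(6)[of q x y] by simp
      then show False using edis[OF pq] by blast
    qed
  qed (simp_all add: P(1) finite_arcs)
  also have "\<dots> \<le> (\<Sum>p\<in>P. T)" using P(4) by (intro sum_mono) (auto simp: c_def)
  also have "\<dots> = k * (2 * T)" using P(2) by simp
  finally have "k * sum c Q0 \<le> k * (2 * T)" using Q0(3) by linarith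
  then have cost: "sum c Q0 \<le> 2 * T" using k(1) by simp
  define Q where "Q = (\<lambda>(x, y). {x, y}) ` Q0"
  have finQ0: "finite Q0" using Q0(1) finJ by (rule finite_subset)
  have "sum w Q \<le> sum (w \<circ> (\<lambda>(x, y). {x, y})) Q0"
    unfolding Q_def using finQ0 by (intro sum_image_le) auto
  also have "w \<circ> (\<lambda>(x, y). {x, y}) = c" by (auto simp: c_def)
  finally have wQ: "sum w Q \<le> 2 * T" using cost by simp
  have QH: "Q \<subseteq> H" using Q0(1) arcH(1) by (auto simp: Q_def J_def)
  have finQ: "finite Q" using QH finH by (rule finite_subset)
  let ?F = "(F - {{u, v}}) \<union> Q"
  \<comment> \<open>Removing \<open>{u, v}\<close> costs one unit of capacity, and the covering
    edge, which is not in \<open>F\<close>, gives it back.\<close>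
  have tightQ: "cut_size V F A B \<le> cut_size V ?F A B"
    if t: "tight V R r F A B" "u \<in> A" "v \<in> B" for A B
  proof -
    have "enc (A, B) \<in> enc ` K" using t by (auto simp: K_def)
    from bspec[OF Q0(2) this] obtain x y where xy: "(x, y) \<in> Q0" "Inl x \<in> enc (A, B)" "Inr y \<notin> enc (A, B)"
      by auto
    have "(x, y) \<in> J" using xy Q0 by auto
    then have "y \<in> V" "{x, y} \<notin> F" using arcH by (auto simp: J_def)
    then have new: "{x, y} \<in> crossing ?F A B" "{x, y} \<notin> F"
      using xy by (force simp: crossing_def Q_def enc_def)+
    have "insert {x, y} (crossing (F - {{u, v}}) A B) \<subseteq> crossing ?F A B"
      using new by (auto simp: crossing_def)
    moreover have "{x, y} \<notin> crossing (F - {{u, v}}) A B" using new by (auto simp: crossing_def)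
    moreover have "finite (crossing ?F A B)" "finite (crossing (F - {{u, v}}) A B)"
      using finF finQ by (auto simp: crossing_def)
    ultimately have "Suc (card (crossing (F - {{u, v}}) A B)) \<le> card (crossing ?F A B)"
      by (metis card_insert_disjoint card_mono)
    then show ?thesis using cut_size_remove_edge[OF finF e(1) t(2,3), of V] by (simp add: cut_size_def)
  qed
  have "cut_feasible V R r ?F"
    unfolding cut_feasible_def
  proof (intro allI ballI impI)
    fix A B a b assume a: "a \<in> A \<inter> R" "b \<in> B \<inter> R" "setpair V R A B"
    have le: "r {a, b} \<le> cut_size V F A B" using feas a by (auto simp: cut_feasible_def)
    have mono: "cut_size V (F - {{u, v}}) A B \<le> cut_size V ?F A B"
      using finF finQ by (intro cut_size_mono) auto
    \<comment> \<open>If the edge crosses the setpair, there is slack for the lost unit unless the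
      setpair is tight. The family \<open>K\<close> fixes one orientation; the reversed one is
      reduced to it by symmetry.\<close>
    consider "u \<in> A \<and> v \<in> B" | "u \<in> B \<and> v \<in> A" | "\<not> (u \<in> A \<and> v \<in> B) \<and> \<not> (u \<in> B \<and> v \<in> A)" by blast
    then show "r {a, b} \<le> cut_size V ?F A B"
    proof cases
      case 1
      show ?thesis
      proof (cases "r {a, b} = cut_size V F A B")
        case True
        then have "tight V R r F A B" using a by (auto simp: tight_def)
        then show ?thesis using tightQ[of A B] 1 True by simp
      next
        case False
        then show ?thesis using le mono cut_size_remove_edge[OF finF e(1), of A B V] 1 by simp
      qed
    next
      case 2
      note comm = cut_size_commute[of V _ A B]
      show ?thesis
      proof (cases "r {a, b} = cut_size V F A B")
        case True
        then have "tight V R r F B A" using a setpair_commute[OF a(3)] comm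
          unfolding tight_def by (metis insert_commute)
        then show ?thesis using tightQ[of B A] 2 True comm by simp
      next
        case False
        then show ?thesis using le mono cut_size_remove_edge[OF finF e(1), of B A V] 2 comm by simp
      qed
    next
      case 3
      then have "crossing (F - {{u, v}}) A B = crossing F A B"
        using a(3) by (auto simp: crossing_def setpair_def)
      then show ?thesis using le mono by (simp add: cut_size_def)
    qed
  qed
  then show ?thesis using QH wQ by blast
qed

section \<open>The Moore bound\<close>

text \<open>Girth greater than \<open>2 * t\<close>: a path with \<open>length p\<close> vertices is
  closed by the edge \<open>{u, v}\<close> to a cycle with \<open>length p\<close> edges.\<close>

definition short_cycle_free :: "nat \<Rightarrow> edge set \<Rightarrow> bool" where
  "short_cycle_free t G \<longleftrightarrow>
     (\<forall>u v p. {u, v} \<in> G \<longrightarrow> is_path (G - {{u, v}}) u v p \<longrightarrow> 2 * t < length p)"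

lemma short_cycle_free_subset: "short_cycle_free t G \<Longrightarrow> G' \<subseteq> G \<Longrightarrow> short_cycle_free t G'"
  unfolding short_cycle_free_def is_path_def by blast

lemma short_cycle_free_walk:
  assumes "short_cycle_free t G" "{u, v} \<in> G" "W \<noteq> []" "hd W = u" "last W = v"
    "successively (\<lambda>x y. {x, y} \<in> G - {{u, v}}) W"
  shows "2 * t < length W"
proof -
  obtain q where q: "q \<noteq> []" "hd q = u" "last q = v" "distinct q"
    "successively (\<lambda>x y. {x, y} \<in> G - {{u, v}}) q" "length q \<le> length W"
    using walk_imp_distinct_walk[OF assms(3,6)] assms(4,5) by blast
  then have "is_path (G - {{u, v}}) u v q" unfolding is_path_iff by blast
  then show ?thesis using assms(1,2) q(6) unfolding short_cycle_free_def by fastforce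
qed

text \<open>Where the paths part, following \<open>q\<close> to \<open>y\<close> and then
  \<open>p\<close> back to its second vertex gives a walk with at most \<open>2 * t\<close> vertices
  that joins the ends of the first edge of \<open>p\<close> without using this edge.\<close>

lemma short_cycle_free_path_unique:
  assumes scf: "short_cycle_free t G"
    and "is_path G x y p" "is_path G x y q" "length p \<le> Suc t" "length q \<le> Suc t"
  shows "p = q"
  using assms(2-5)
proof (induction p arbitrary: x q)
  case Nil
  then show ?case by (simp add: is_path_def)
next
  case (Cons x' p)
  have [simp]: "x' = x" using Cons.prems by (simp add: is_path_def)
  obtain q' where q: "q = x # q'" using Cons.prems(2) by (cases q) (auto simp: is_path_def)
  show ?case
  proof (cases "p = [] \<or> q' = []")
    case True
    then show ?thesis using Cons.prems q by (auto simp: is_path_def split: if_splits)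
  next
    case False
    then have ne: "p \<noteq> []" "q' \<noteq> []" by auto
    have p': "is_path G (hd p) y p" and q'': "is_path G (hd q') y q'"
      using Cons.prems(1,2) ne unfolding q by (auto simp: is_path_iff successively_Cons)
    have E: "{x, hd p} \<in> G" "{x, hd q'} \<in> G" and x: "x \<notin> set p" "x \<notin> set q'"
      using Cons.prems(1,2) ne unfolding q by (auto simp: is_path_iff successively_Cons)
    show ?thesis
    proof (cases "hd p = hd q'")
      case True
      then have "p = q'" using Cons.IH[of "hd p" q'] p' q'' Cons.prems(3,4) q by simp
      then show ?thesis using q by simp
    next
      case False
      obtain z where z: "p = z @ [y]"
        using p' ne(1) by (metis append_butlast_last_id is_path_def)
      let ?a = "hd p" and ?W = "q @ rev z"
      have av: "successively (\<lambda>b c. {b, c} \<in> G - {{x, ?a}}) l"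
        if "successively (\<lambda>b c. {b, c} \<in> G) l" "x \<notin> set l" for l
        using that(1) by (rule successively_mono) (use that(2) in \<open>auto simp: doubleton_eq_iff\<close>)
      have "successively (\<lambda>b c. {b, c} \<in> G - {{x, ?a}}) q'"
        using q'' x(2) by (intro av) (auto simp: is_path_iff)
      then have sq: "successively (\<lambda>b c. {b, c} \<in> G - {{x, ?a}}) q"
        using E(2) False ne(2) unfolding q by (auto simp: successively_Cons doubleton_eq_iff)
      have "successively (\<lambda>b c. {b, c} \<in> G - {{x, ?a}}) p"
        using p' x(1) by (intro av) (auto simp: is_path_iff)
      then have "successively (\<lambda>b c. {b, c} \<in> G - {{x, ?a}}) (rev p)"
        by (simp add: insert_commute)
      then have sz: "successively (\<lambda>b c. {b, c} \<in> G - {{x, ?a}}) (y # rev z)"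
        unfolding z by simp
      have lq: "q \<noteq> []" "last q = y" using Cons.prems(2) by (auto simp: is_path_def)
      have W: "successively (\<lambda>b c. {b, c} \<in> G - {{x, ?a}}) ?W"
        using sq sz lq by (auto simp: successively_append_iff successively_Cons)
      have "last ?W = ?a" using lq by (cases z) (auto simp: z)
      then have "2 * t < length ?W"
        using short_cycle_free_walk[OF scf E(1) _ _ _ W] q by simp
      then show ?thesis using Cons.prems(3,4) z by simp
    qed
  qed
qed

text \<open>If \<open>y\<close> came earlier on \<open>p\<close> than the last vertex but one, the
  rest of \<open>p\<close> and the edge \<open>{z, y}\<close> would form a cycle with at most
  \<open>length p\<close> edges.\<close>

lemma short_cycle_free_back_edge:
  assumes scf: "short_cycle_free t G" and p: "is_path G x z p" and len: "length p \<le> 2 * t"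
    and y: "{z, y} \<in> G" "y \<in> set p" "y \<noteq> z"
  shows "y = last (butlast p)"
proof -
  obtain p1 p2 where pp: "p = p1 @ y # p2" using y(2) split_list by fastforce
  have ne: "p2 \<noteq> []" and l: "last p2 = z" using p y(3) by (auto simp: is_path_def pp split: if_splits)
  have d: "distinct (y # p2)" and s: "successively (\<lambda>a b. {a, b} \<in> G) (y # p2)"
    using p by (auto simp: is_path_iff pp successively_append_iff)
  have "hd p2 = z"
  proof (rule ccontr)
    assume h: "hd p2 \<noteq> z"
    have "successively (\<lambda>a b. {a, b} \<in> G - {{y, z}}) p2"
      by (rule successively_mono[of "\<lambda>a b. {a, b} \<in> G"])
        (use s d ne in \<open>auto simp: successively_Cons doubleton_eq_iff\<close>)
    then have "successively (\<lambda>a b. {a, b} \<in> G - {{y, z}}) (y # p2)"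
      using s ne h by (auto simp: successively_Cons doubleton_eq_iff)
    then have "2 * t < length (y # p2)"
      using short_cycle_free_walk[OF scf, of y z "y # p2"] y(1) ne l by (simp add: insert_commute)
    then show False using len pp by simp
  qed
  then have "p2 = [z]" using ne l d by (cases p2) (auto split: if_splits)
  then show ?thesis using pp by (simp add: butlast_append)
qed

text \<open>Up to \<open>t\<close> edges the paths from \<open>x0\<close> branch like a tree: each
  can be continued in \<open>d\<close> ways, since at most its previous vertex is lost among more
  than \<open>d\<close> neighbours, and those with \<open>t\<close> edges have different ends by
  uniqueness.\<close>

lemma min_degree_moore_bound:
  assumes U: "finite U" "G \<subseteq> [U]\<^bsup>2\<^esup>" "U \<noteq> {}" and scf: "short_cycle_free t G"
    and deg: "\<And>x. x \<in> U \<Longrightarrow> d < card {y. {x, y} \<in> G}"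
  shows "d ^ t \<le> card U"
proof -
  obtain x0 where x0: "x0 \<in> U" using U by blast
  define Ps where "Ps j = {p. is_path G x0 (last p) p \<and> length p = Suc j}" for j
  have PsU: "set p \<subseteq> U" if "p \<in> Ps j" for p j
    using that is_path_vertices[OF _ U(2) x0] by (auto simp: Ps_def)
  have finPs: "finite (Ps j)" for j
    by (rule finite_subset[OF _ finite_lists_length_eq[OF U(1), of "Suc j"]])
      (use PsU in \<open>auto simp: Ps_def\<close>)
  have "d ^ j \<le> card (Ps j)" if "j \<le> t" for j
    using that
  proof (induction j)
    case 0
    have "[x0] \<in> Ps 0" by (simp add: Ps_def is_path_iff)
    then have "card (Ps 0) \<noteq> 0" using finPs by auto
    then show ?case by simp
  next
    case (Suc j)
    define ext where "ext p = {y. {last p, y} \<in> G \<and> y \<notin> set p}" for p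
    have ext: "d \<le> card (ext p)" if p: "p \<in> Ps j" for p
    proof -
      have lU: "last p \<in> U" using PsU[OF p] p by (auto simp: Ps_def is_path_def)
      have path: "is_path G x0 (last p) p" and len: "length p \<le> 2 * t"
        using p Suc.prems by (auto simp: Ps_def)
      \<comment> \<open>For the one-vertex path \<open>last (butlast p)\<close> is the unspecified
        \<open>last []\<close>; it costs at most one neighbour, as a true predecessor does.\<close>
      have "{y. {last p, y} \<in> G} \<subseteq> insert (last (butlast p)) (ext p)"
        using short_cycle_free_back_edge[OF scf path len] U(2) by (auto simp: ext_def)
      moreover have fe: "finite (ext p)"
        by (rule finite_subset[OF _ U(1)]) (use U(2) in \<open>auto simp: ext_def\<close>)
      ultimately have "card {y. {last p, y} \<in> G} \<le> card (insert (last (butlast p)) (ext p))"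
        by (intro card_mono) auto
      then show ?thesis using deg[OF lU] fe by (simp add: card_insert_if split: if_splits)
    qed
    have sub: "(\<lambda>(p, y). p @ [y]) ` (SIGMA p:Ps j. ext p) \<subseteq> Ps (Suc j)"
      by (auto simp: Ps_def ext_def is_path_iff successively_append_iff)
    have inj: "inj_on (\<lambda>(p, y). p @ [y]) (SIGMA p:Ps j. ext p)" by (auto simp: inj_on_def)
    have fe: "finite (ext p)" for p
      by (rule finite_subset[OF _ U(1)]) (use U(2) in \<open>auto simp: ext_def\<close>)
    have "d ^ Suc j \<le> card (Ps j) * d" using Suc by simp
    also have "\<dots> \<le> (\<Sum>p\<in>Ps j. card (ext p))"
      using ext sum_bounded_below[of "Ps j" d "\<lambda>p. card (ext p)"] by simp
    also have "\<dots> = card (SIGMA p:Ps j. ext p)" using finPs fe by (simp add: card_SigmaI)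
    also have "\<dots> \<le> card (Ps (Suc j))" by (rule card_inj_on_le[OF inj sub finPs])
    finally show ?case .
  qed
  moreover have "card (Ps t) \<le> card U"
  proof (rule card_inj_on_le[of last])
    show "inj_on last (Ps t)"
    proof (rule inj_onI)
      fix p q assume "p \<in> Ps t" "q \<in> Ps t" "last p = last q"
      then show "p = q"
        using short_cycle_free_path_unique[OF scf, of x0 "last p" p q] by (simp add: Ps_def)
    qed
    show "last ` Ps t \<subseteq> U"
    proof (rule image_subsetI)
      fix p assume "p \<in> Ps t"
      then show "last p \<in> U" using PsU[of p t] by (auto simp: Ps_def is_path_def)
    qed
  qed (rule U)
  ultimately show ?thesis using le_trans by blast
qed

text \<open>Deleting a vertex of degree at most \<open>d\<close> loses at most \<open>d\<close>
  edges, so there remain more than \<open>d\<close> edges per vertex. The empty graph violates this,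
  hence the deletions stop earlier.\<close>

lemma exists_min_degree_subgraph:
  assumes "finite U" "G \<subseteq> [U]\<^bsup>2\<^esup>" "d * card U < card G"
  shows "\<exists>U'. U' \<subseteq> U \<and> U' \<noteq> {} \<and> (\<forall>x\<in>U'. d < card {y. {x, y} \<in> G \<inter> [U']\<^bsup>2\<^esup>})"
  using assms
proof (induction "card U" arbitrary: U G)
  case 0
  then have "U = {}" by simp
  then have "G = {}" using "0.prems"(2) by (auto simp: nsets_2_eq)
  then show ?case using "0.prems"(3) by simp
next
  case (Suc m)
  show ?case
  proof (cases "\<forall>x\<in>U. d < card {y. {x, y} \<in> G}")
    case True
    moreover have "G \<inter> [U]\<^bsup>2\<^esup> = G" using Suc.prems(2) by blast
    moreover have "U \<noteq> {}" using Suc.hyps(2) by auto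
    ultimately show ?thesis by (intro exI[of _ U]) auto
  next
    case False
    then obtain x where x: "x \<in> U" "card {y. {x, y} \<in> G} \<le> d" by force
    let ?U = "U - {x}" and ?G = "{e \<in> G. x \<notin> e}"
    have finG: "finite G" using Suc.prems by (meson finite_imp_finite_nsets finite_subset)
    have fy: "finite {y. {x, y} \<in> G}"
      by (rule finite_subset[OF _ Suc.prems(1)]) (use Suc.prems(2) in auto)
    have "{e \<in> G. x \<in> e} \<subseteq> (\<lambda>y. {x, y}) ` {y. {x, y} \<in> G}"
    proof
      fix e assume e: "e \<in> {e \<in> G. x \<in> e}"
      then have "e \<in> [U]\<^bsup>2\<^esup>" using Suc.prems(2) by blast
      then obtain a b where "e = {a, b}" by (rule nsets2_E)
      then show "e \<in> (\<lambda>y. {x, y}) ` {y. {x, y} \<in> G}" using e by (auto simp: insert_commute)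
    qed
    then have "card {e \<in> G. x \<in> e} \<le> d"
      using x(2) fy by (meson card_image_le card_mono finite_imageI le_trans)
    moreover have "card G = card ?G + card {e \<in> G. x \<in> e}"
    proof -
      have "G = ?G \<union> {e \<in> G. x \<in> e}" by blast
      then show ?thesis using finG card_Un_disjoint[of ?G "{e \<in> G. x \<in> e}"] by fastforce
    qed
    moreover have cU: "card U = Suc (card ?U)" by (rule card_Suc_Diff1[OF Suc.prems(1) x(1), symmetric])
    moreover have "d * card U = d * card ?U + d" unfolding cU by simp
    ultimately have "d * card ?U < card ?G" using Suc.prems(3) by linarith
    moreover have "?G \<subseteq> [?U]\<^bsup>2\<^esup>" using Suc.prems(2) by (auto simp: nsets_def)
    moreover have "m = card ?U" using cU Suc.hyps(2) by linarith
    ultimately obtain U' where U': "U' \<subseteq> ?U" "U' \<noteq> {}"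
      "\<forall>x\<in>U'. d < card {y. {x, y} \<in> ?G \<inter> [U']\<^bsup>2\<^esup>}"
      using Suc.hyps(1)[of ?U ?G] Suc.prems(1) by blast
    have "?G \<inter> [U']\<^bsup>2\<^esup> = G \<inter> [U']\<^bsup>2\<^esup>" using U'(1) by (auto simp: nsets_def)
    then show ?thesis using U' by (intro exI[of _ U']) auto
  qed
qed

lemma moore_bound_nat:
  assumes "finite U" "G \<subseteq> [U]\<^bsup>2\<^esup>" "short_cycle_free t G" "d * card U < card G"
  shows "d ^ t \<le> card U"
proof -
  obtain U' where U': "U' \<subseteq> U" "U' \<noteq> {}" "\<forall>x\<in>U'. d < card {y. {x, y} \<in> G \<inter> [U']\<^bsup>2\<^esup>}"
    using exists_min_degree_subgraph[OF assms(1,2,4)] by blast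
  have "d ^ t \<le> card U'"
    by (rule min_degree_moore_bound[of U' "G \<inter> [U']\<^bsup>2\<^esup>"])
      (use U' assms in \<open>auto intro: finite_subset short_cycle_free_subset\<close>)
  also have "\<dots> \<le> card U" using U' assms by (intro card_mono)
  finally show ?thesis .
qed

lemma moore_bound:
  assumes "finite U" "G \<subseteq> [U]\<^bsup>2\<^esup>" "short_cycle_free t G" "t \<ge> 1"
  shows "real (card G) \<le> 2 * real (card U) powr (1 + 1 / real t)"
proof (cases "card U = 0")
  case True
  then have "G = {}" using assms(1,2) by (auto simp: nsets_2_eq)
  then show ?thesis by simp
next
  case False
  define N where "N = card U"
  have N: "real N \<ge> 1" using False by (simp add: N_def)
  define b where "b = real N powr (1 / real t)"
  have b1: "b \<ge> 1" using N by (simp add: b_def ge_one_powr_ge_zero)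
  \<comment> \<open>The smallest integer above \<open>b\<close>: then \<open>d ^ t\<close> exceeds
    \<open>N\<close>, so \<open>moore_bound_nat\<close> forces at most \<open>d * N\<close>
    edges.\<close>
  define d where "d = nat \<lfloor>b\<rfloor> + 1"
  have db: "b < real d" "real d \<le> b + 1" using b1 by (auto simp: d_def) linarith+
  have "real N = b ^ t" using N assms(4) by (simp add: b_def powr_power)
  also have "\<dots> < real d ^ t" using db b1 assms(4) by (intro power_strict_mono) auto
  finally have "N < d ^ t" by (metis of_nat_less_iff of_nat_power)
  then have "card G \<le> d * N" using moore_bound_nat[OF assms(1-3), of d] by (force simp: N_def)
  then have "real (card G) \<le> real d * real N" by (metis of_nat_le_iff of_nat_mult)
  also have "\<dots> \<le> (2 * b) * real N" using db b1 by (intro mult_right_mono) auto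
  also have "\<dots> = 2 * real N powr (1 + 1 / real t)" using N by (simp add: b_def powr_add)
  finally show ?thesis by (simp add: N_def)
qed

section \<open>Graphs with blocking sets\<close>

lemma card_supersets_of_size:
  assumes "finite V" "T \<subseteq> V" "card T \<le> s"
  shows "card {X \<in> [V]\<^bsup>s\<^esup>. T \<subseteq> X} = (card V - card T) choose (s - card T)"
proof -
  have finT: "finite T" using assms finite_subset by blast
  have "bij_betw (\<lambda>X. X - T) {X \<in> [V]\<^bsup>s\<^esup>. T \<subseteq> X} {Y. Y \<subseteq> V - T \<and> card Y = s - card T}"
  proof (rule bij_betw_byWitness[where f' = "\<lambda>Y. Y \<union> T"])
    show "(\<lambda>X. X - T) ` {X \<in> [V]\<^bsup>s\<^esup>. T \<subseteq> X} \<subseteq> {Y. Y \<subseteq> V - T \<and> card Y = s - card T}"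
      using finT by (auto simp: nsets_def card_Diff_subset)
    show "(\<lambda>Y. Y \<union> T) ` {Y. Y \<subseteq> V - T \<and> card Y = s - card T} \<subseteq> {X \<in> [V]\<^bsup>s\<^esup>. T \<subseteq> X}"
    proof (rule image_subsetI)
      fix Y assume "Y \<in> {Y. Y \<subseteq> V - T \<and> card Y = s - card T}"
      then have Y: "Y \<subseteq> V - T" "card Y = s - card T" by auto
      have "finite Y" using Y assms(1) by (meson finite_Diff finite_subset)
      moreover have "Y \<inter> T = {}" using Y by auto
      ultimately have "card (Y \<union> T) = s" using Y finT assms(3) by (simp add: card_Un_disjoint)
      then show "Y \<union> T \<in> {X \<in> [V]\<^bsup>s\<^esup>. T \<subseteq> X}" using Y assms(2) \<open>finite Y\<close> finT by (auto simp: nsets_def)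
    qed
  qed auto
  then have "card {X \<in> [V]\<^bsup>s\<^esup>. T \<subseteq> X} = card {Y. Y \<subseteq> V - T \<and> card Y = s - card T}"
    by (rule bij_betw_same_card)
  also have "\<dots> = card (V - T) choose (s - card T)" using assms by (intro n_subsets) auto
  finally show ?thesis using assms finT by (simp add: card_Diff_subset)
qed

text \<open>The sampling argument of Bodwin and Patel: on average over the vertex sets \<open>X\<close> of size about
  \<open>n / (2 f)\<close>, at least half of the edges inside \<open>X\<close> have a blocking set that avoids \<open>X\<close>.\<close>

lemma blocked_graph_double_count:
  assumes V: "finite V" "card V = n" "n \<ge> 2" and G: "G \<subseteq> [V]\<^bsup>2\<^esup>" and t: "t \<ge> 1" and f: "f \<ge> 1"
    and Z: "\<And>e. e \<in> G \<Longrightarrow> Z e \<subseteq> V \<and> Z e \<inter> e = {} \<and> card (Z e) \<le> f"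
    and scf: "\<And>X. X \<subseteq> V \<Longrightarrow> short_cycle_free t {e \<in> G. e \<subseteq> X \<and> Z e \<inter> X = {}}"
    and s: "s = 2 + (n - 2) div (2 * f)"
  shows "real (card G) * (real s * (real s - 1))
    \<le> 4 * (real n * (real n - 1)) * real s powr (1 + 1 / real t)"
proof -
  define M where "M = (n - 2) choose (s - 2)"
  define XX where "XX = [V]\<^bsup>s\<^esup>"
  have fin: "finite XX" "finite G" using V G unfolding XX_def
    by (auto intro: finite_imp_finite_nsets finite_subset)
  \<comment> \<open>The shift by 2 in \<open>s\<close> makes room for the ends of an edge. Among the
    samples that contain the edge, a given third vertex occurs in the fraction
    \<open>(s - 2) / (n - 2)\<close>, which is at most \<open>1 / (2 * f)\<close>.\<close>
  have s2: "2 * f * (s - 2) \<le> n - 2" unfolding s by (simp add: div_times_less_eq_dividend)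
  have sn: "s \<le> n"
  proof -
    have "(n - 2) div (2 * f) \<le> n - 2" by simp
    then show ?thesis unfolding s using V(3) by linarith
  qed
  have Mpos: "M > 0" unfolding M_def using sn by (simp add: zero_less_binomial_iff diff_le_mono)
  have c2: "card {X \<in> XX. e \<subseteq> X} = M" if "e \<in> G" for e
  proof -
    have "e \<subseteq> V" "card e = 2" using that G by (auto simp: nsets_def)
    then show ?thesis unfolding XX_def M_def using card_supersets_of_size[OF V(1), of e s] V(2)
      by (simp add: s)
  qed
  have c3: "2 * f * card {X \<in> XX. insert x e \<subseteq> X} \<le> M" if e: "e \<in> G" "x \<in> Z e" for e x
  proof -
    have ev: "e \<subseteq> V" "card e = 2" "finite e" using e G by (auto simp: nsets_def)
    have "x \<in> V" "x \<notin> e" using Z e by auto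
    then have T: "insert x e \<subseteq> V" "card (insert x e) = 3" using ev by auto
    show ?thesis
    \<comment> \<open>A sample of two vertices has no room for a third one, and the formula for
      supersets applies only from \<open>s = 3\<close> on.\<close>
    proof (cases "s = 2")
      case True
      have "{X \<in> XX. insert x e \<subseteq> X} = {}"
      proof (intro equals0I)
        fix X assume "X \<in> {X \<in> XX. insert x e \<subseteq> X}"
        then have "card X = 2" "finite X" "insert x e \<subseteq> X" using True by (auto simp: XX_def nsets_def)
        then show False using T(2) card_mono[of X "insert x e"] by simp
      qed
      then show ?thesis by (metis card.empty mult_0_right le0)
    next
      case False
      then have s3: "s \<ge> 3" using s by simp
      then obtain a where a: "s = a + 3" by (metis add.commute le_Suc_ex)
      obtain b where b: "n = b + 3" using sn s3 by (metis add.commute le_Suc_ex le_trans)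
      have card3: "card {X \<in> XX. insert x e \<subseteq> X} = (b choose a)"
        using card_supersets_of_size[OF V(1) T(1), of s] T(2) s3 V(2) unfolding XX_def
        by (simp add: a b)
      have Mab: "M = (Suc b choose Suc a)" by (simp add: M_def a b Suc_diff_le numeral_eq_Suc)
      have "2 * f * (b choose a) * Suc b = 2 * f * (Suc a * (Suc b choose Suc a))"
        using Suc_times_binomial_eq[of b a] by (metis mult.assoc mult.commute)
      also have "\<dots> = (2 * f * Suc a) * M" by (simp only: Mab mult.assoc)
      also have "\<dots> \<le> Suc b * M"
      proof (rule mult_right_mono)
        show "2 * f * Suc a \<le> Suc b" using s2 by (simp add: a b)
      qed simp
      finally have "2 * f * (b choose a) * Suc b \<le> M * Suc b" by (simp add: mult.commute)
      then show ?thesis unfolding card3 by (metis mult_le_cancel2 zero_less_Suc)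
    qed
  qed
  define good where "good e X \<longleftrightarrow> e \<subseteq> X \<and> Z e \<inter> X = {}" for e X
  \<comment> \<open>Union bound: there are at most \<open>f\<close> blocking vertices, and each
    spoils at most the fraction \<open>1 / (2 * f)\<close> of the \<open>M\<close> samples around
    \<open>e\<close>.\<close>
  have cgood: "M \<le> 2 * card {X \<in> XX. good e X}" if e: "e \<in> G" for e
  proof -
    have Ze: "finite (Z e)" "card (Z e) \<le> f" using Z[OF e] V(1) by (auto intro: finite_subset)
    have "{X \<in> XX. e \<subseteq> X} \<subseteq> {X \<in> XX. good e X} \<union> (\<Union>x\<in>Z e. {X \<in> XX. insert x e \<subseteq> X})"
      by (auto simp: good_def)
    then have "M \<le> card ({X \<in> XX. good e X} \<union> (\<Union>x\<in>Z e. {X \<in> XX. insert x e \<subseteq> X}))"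
      unfolding c2[OF e, symmetric] using fin Ze by (intro card_mono) auto
    also have "\<dots> \<le> card {X \<in> XX. good e X} + card (\<Union>x\<in>Z e. {X \<in> XX. insert x e \<subseteq> X})"
      by (rule card_Un_le)
    also have "card (\<Union>x\<in>Z e. {X \<in> XX. insert x e \<subseteq> X})
        \<le> (\<Sum>x\<in>Z e. card {X \<in> XX. insert x e \<subseteq> X})"
      by (rule card_UN_le[OF Ze(1)])
    finally have 1: "M \<le> card {X \<in> XX. good e X} + (\<Sum>x\<in>Z e. card {X \<in> XX. insert x e \<subseteq> X})"
      by simp
    have "f * (2 * (\<Sum>x\<in>Z e. card {X \<in> XX. insert x e \<subseteq> X}))
        = (\<Sum>x\<in>Z e. 2 * f * card {X \<in> XX. insert x e \<subseteq> X})"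
      by (simp add: sum_distrib_left mult.assoc mult.left_commute)
    also have "\<dots> \<le> (\<Sum>x\<in>Z e. M)" using c3[OF e] by (intro sum_mono)
    also have "\<dots> \<le> f * M" using Ze by simp
    finally have "2 * (\<Sum>x\<in>Z e. card {X \<in> XX. insert x e \<subseteq> X}) \<le> M" using f by simp
    then show ?thesis using 1 by linarith
  qed
  have ce: "card {x \<in> S. P x} = (\<Sum>x\<in>S. if P x then 1 else 0)" if "finite S" for S :: "'x set" and P
    using that by (simp add: sum.If_cases Int_def)
  have "card G * M = (\<Sum>e\<in>G. M)" by simp
  also have "\<dots> \<le> (\<Sum>e\<in>G. 2 * card {X \<in> XX. good e X})" using cgood by (intro sum_mono)
  also have "\<dots> = 2 * (\<Sum>e\<in>G. \<Sum>X\<in>XX. if good e X then 1 else 0)"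
    by (simp add: sum_distrib_left[symmetric] ce[OF fin(1)])
  also have "(\<Sum>e\<in>G. \<Sum>X\<in>XX. if good e X then 1 else 0 :: nat)
      = (\<Sum>X\<in>XX. \<Sum>e\<in>G. if good e X then 1 else 0)" by (rule sum.swap)
  also have "\<dots> = (\<Sum>X\<in>XX. card {e \<in> G. good e X})" by (simp add: ce[OF fin(2)])
  finally have "real (card G * M) \<le> real (2 * (\<Sum>X\<in>XX. card {e \<in> G. good e X}))"
    by (rule of_nat_mono)
  then have "real (card G) * real M \<le> 2 * (\<Sum>X\<in>XX. real (card {e \<in> G. good e X}))" by simp
  also have "(\<Sum>X\<in>XX. real (card {e \<in> G. good e X}))
      \<le> (\<Sum>X\<in>XX. 2 * real s powr (1 + 1 / real t))"
  proof (rule sum_mono)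
    fix X assume "X \<in> XX"
    then have X: "X \<subseteq> V" "card X = s" "finite X" by (auto simp: XX_def nsets_def)
    have "{e \<in> G. good e X} \<subseteq> [X]\<^bsup>2\<^esup>" using G by (auto simp: good_def nsets_def)
    moreover have "short_cycle_free t {e \<in> G. good e X}" using scf[OF X(1)] by (simp add: good_def)
    ultimately show "real (card {e \<in> G. good e X}) \<le> 2 * real s powr (1 + 1 / real t)"
      using moore_bound[OF X(3) _ _ t] X(2) by simp
  qed
  also have "\<dots> = real (n choose s) * (2 * real s powr (1 + 1 / real t))"
    using V by (simp add: XX_def)
  finally have main: "real (card G) * real M \<le> 4 * real (n choose s) * real s powr (1 + 1 / real t)"
    by simp
  \<comment> \<open>Both sides count the samples together with an ordered pair of distinct vertices
    in them; this eliminates the two binomials.\<close>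
  have ns: "real (n choose s) * (real s * (real s - 1)) = real n * (real n - 1) * real M"
  proof -
    obtain a where a: "s = Suc (Suc a)" using s by auto
    obtain b where b: "n = Suc (Suc b)" using V(3) by (metis add_2_eq_Suc le_Suc_ex)
    have "Suc (Suc a) * (Suc (Suc b) choose Suc (Suc a)) = Suc (Suc b) * (Suc b choose Suc a)"
      by (metis Suc_times_binomial_eq mult.commute)
    moreover have "Suc a * (Suc b choose Suc a) = Suc b * (b choose a)"
      by (metis Suc_times_binomial_eq mult.commute)
    ultimately have "(n choose s) * (s * Suc a) = n * Suc b * M"
      unfolding a b M_def by (metis diff_Suc_Suc diff_zero mult.assoc mult.commute mult.left_commute numeral_2_eq_2)
    then have "real (n choose s) * (real s * real (Suc a)) = real n * real (Suc b) * real M"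
      by (metis of_nat_mult)
    then show ?thesis by (simp add: a b)
  qed
  have sp: "real s * (real s - 1) \<ge> 0" using s by simp
  have "real (card G) * (real s * (real s - 1)) * real M
      = (real (card G) * real M) * (real s * (real s - 1))" by simp
  also have "\<dots> \<le> (4 * real (n choose s) * real s powr (1 + 1 / real t)) * (real s * (real s - 1))"
    by (rule mult_right_mono[OF main sp])
  also have "\<dots> = 4 * (real (n choose s) * (real s * (real s - 1))) * real s powr (1 + 1 / real t)"
    by simp
  also have "\<dots> = 4 * (real n * (real n - 1)) * real s powr (1 + 1 / real t) * real M"
    unfolding ns by simp
  finally show ?thesis using Mpos by simp
qed

text \<open>With \<open>s\<close> about \<open>n / (2 * f)\<close>, the double count bounds
  \<open>card G\<close> by a constant times \<open>(n / s) ^ 2\<close> times the Moore bound for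
  \<open>s\<close> vertices. The constant grows from 4 to 8 because \<open>s * (s - 1)\<close> is
  only known to be at least half of \<open>s * s\<close>.\<close>

lemma blocked_graph_size:
  assumes V: "finite V" "card V = n" "n \<ge> 2" and G: "G \<subseteq> [V]\<^bsup>2\<^esup>" and t: "t \<ge> 1" and f: "f \<ge> 1"
    and Z: "\<And>e. e \<in> G \<Longrightarrow> Z e \<subseteq> V \<and> Z e \<inter> e = {} \<and> card (Z e) \<le> f"
    and scf: "\<And>X. X \<subseteq> V \<Longrightarrow> short_cycle_free t {e \<in> G. e \<subseteq> X \<and> Z e \<inter> X = {}}"
  shows "real (card G) \<le> 8 * (2 * real f) powr (1 - 1 / real t) * real n powr (1 + 1 / real t)"
proof -
  define s where "s = 2 + (n - 2) div (2 * f)"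
  define \<alpha> where "\<alpha> = 1 / real t"
  have \<alpha>: "\<alpha> \<le> 1" "\<alpha> \<ge> 0" using t by (auto simp: \<alpha>_def)
  have s2: "real s \<ge> 2" by (simp add: s_def)
  have sl: "real n / (2 * real f) \<le> real s"
  proof -
    have "real (n - 2) \<le> real ((n - 2) div (2 * f)) * (2 * real f) + 2 * real f"
    proof -
      have "n - 2 < Suc ((n - 2) div (2 * f)) * (2 * f)"
        using f dividend_less_div_times[of "2 * f" "n - 2"] by simp
      then have "real (n - 2) < real (Suc ((n - 2) div (2 * f)) * (2 * f))" by (simp only: of_nat_less_iff)
      then show ?thesis by (simp add: algebra_simps)
    qed
    then have "real n \<le> real s * (2 * real f)" using V(3) f
      by (simp add: s_def of_nat_diff algebra_simps)
    then show ?thesis using f by (simp add: divide_le_eq)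
  qed
  have n0: "real n > 0" using V by simp
  have "real (card G) * (real s * (real s - 1))
      \<le> 4 * (real n * (real n - 1)) * real s powr (1 + \<alpha>)"
    unfolding \<alpha>_def by (rule blocked_graph_double_count[OF V G t f Z scf s_def])
  also have "\<dots> \<le> 4 * (real n * real n) * real s powr (1 + \<alpha>)"
    using n0 by (intro mult_right_mono mult_left_mono) auto
  finally have 1: "real (card G) * (real s * (real s - 1)) \<le> 4 * (real n * real n) * real s powr (1 + \<alpha>)" .
  have "real (card G) * (real s * real s) \<le> 2 * (real (card G) * (real s * (real s - 1)))"
  proof -
    have "real s * real s \<le> 2 * (real s * (real s - 1))" using s2 by (simp add: algebra_simps)
    then have "real (card G) * (real s * real s) \<le> real (card G) * (2 * (real s * (real s - 1)))"
      by (rule mult_left_mono) simp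
    then show ?thesis by simp
  qed
  also have "\<dots> \<le> 8 * (real n * real n) * real s powr (1 + \<alpha>)" using 1 by linarith
  also have "real s powr (1 + \<alpha>) = real s powr (\<alpha> - 1) * (real s * real s)"
  proof -
    have "real s powr (1 + \<alpha>) = real s powr (\<alpha> - 1) * real s powr 2"
      by (simp only: powr_add[symmetric]) simp
    then show ?thesis using s2 by (simp add: power2_eq_square)
  qed
  finally have "real (card G) * (real s * real s)
      \<le> 8 * (real n * real n) * real s powr (\<alpha> - 1) * (real s * real s)" by simp
  then have "real (card G) \<le> 8 * (real n * real n) * real s powr (\<alpha> - 1)"
    using s2 by (simp add: mult_le_cancel_right)
  \<comment> \<open>The exponent is not positive, so the lower bound on \<open>s\<close> is the
    useful one.\<close>
  also have "real s powr (\<alpha> - 1) \<le> (real n / (2 * real f)) powr (\<alpha> - 1)"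
    using \<alpha> sl n0 f by (intro powr_mono2') auto
  also have "\<dots> = real n powr (\<alpha> - 1) * (2 * real f) powr (1 - \<alpha>)"
  proof -
    have "(2 * real f) powr (1 - \<alpha>) = inverse ((2 * real f) powr (\<alpha> - 1))"
      by (metis minus_diff_eq powr_minus)
    moreover have "(real n / (2 * real f)) powr (\<alpha> - 1)
        = real n powr (\<alpha> - 1) / (2 * real f) powr (\<alpha> - 1)"
      by (rule powr_divide)
    ultimately show ?thesis by (simp only: divide_inverse)
  qed
  also have "8 * (real n * real n) * (real n powr (\<alpha> - 1) * (2 * real f) powr (1 - \<alpha>))
      = 8 * (2 * real f) powr (1 - \<alpha>) * real n powr (1 + \<alpha>)"
  proof -
    have "real n powr (1 + \<alpha>) = real n powr 2 * real n powr (\<alpha> - 1)"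
      by (simp only: powr_add[symmetric]) simp
    then show ?thesis using n0 by (simp add: power2_eq_square)
  qed
  finally show ?thesis using n0 by (simp add: \<alpha>_def)
qed

text \<open>\<open>rk\<close> is the order of insertion. When the last edge of a short cycle inside
  \<open>X\<close> was inserted, the rest of the cycle was present, so the blocking set of that edge
  meets the cycle and hence \<open>X\<close>, which is excluded.\<close>

lemma blocked_greedy_short_cycle_free:
  assumes G: "G \<subseteq> [V]\<^bsup>2\<^esup>" and rk: "inj_on rk G"
    and block: "\<And>u v p. {u, v} \<in> G \<Longrightarrow> is_path {g \<in> G. rk g < (rk {u, v} :: nat)} u v p \<Longrightarrow>
      length p \<le> 2 * t \<Longrightarrow> set p \<inter> Z {u, v} \<noteq> {}"
  shows "short_cycle_free t {e \<in> G. e \<subseteq> X \<and> Z e \<inter> X = {}}"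
  unfolding short_cycle_free_def
proof (intro allI impI, rule ccontr)
  fix u v p
  define GX where "GX = {e \<in> G. e \<subseteq> X \<and> Z e \<inter> X = {}}"
  assume uv: "{u, v} \<in> {e \<in> G. e \<subseteq> X \<and> Z e \<inter> X = {}}"
    and p0: "is_path ({e \<in> G. e \<subseteq> X \<and> Z e \<inter> X = {}} - {{u, v}}) u v p" and "\<not> 2 * t < length p"
  then have uvX: "{u, v} \<in> GX" and p: "is_path (GX - {{u, v}}) u v p" and len: "length p \<le> 2 * t"
    by (auto simp: GX_def)
  define C where "C = insert {u, v} (path_edges p)"
  have finC: "finite C" by (simp add: C_def path_edges_arcs finite_arcs)
  have CG: "C \<subseteq> GX" using p uvX by (auto simp: C_def is_path_def)
  have GXX: "GX - {{u, v}} \<subseteq> [X]\<^bsup>2\<^esup>" using G by (auto simp: GX_def nsets_def)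
  have setp: "set p \<subseteq> X" by (rule is_path_vertices[OF p GXX]) (use uvX in \<open>auto simp: GX_def\<close>)
  obtain g where g: "g \<in> C" "\<forall>h\<in>C. rk h \<le> rk g"
  proof -
    have "Max (rk ` C) \<in> rk ` C" using finC by (intro Max_in) (auto simp: C_def)
    then obtain g where "g \<in> C" "rk g = Max (rk ` C)" by force
    then show thesis using finC by (intro that[of g]) auto
  qed
  have low: "h \<in> {h \<in> G. rk h < rk g}" if "h \<in> C" "h \<noteq> g" for h
  proof -
    have "h \<in> G" "g \<in> G" using that g CG by (auto simp: GX_def)
    then have "rk h \<noteq> rk g" using rk that by (auto simp: inj_on_def)
    then show ?thesis using g that \<open>h \<in> G\<close> by (auto simp: le_less)
  qed
  have contra: False
    if q: "g = {x, y}" "is_path {h \<in> G. rk h < rk g} x y q" "length q \<le> 2 * t" "set q \<subseteq> X" for x y q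
  proof -
    have "{x, y} \<in> GX" using g CG q(1) by blast
    then have "{x, y} \<in> G" "Z {x, y} \<inter> X = {}" by (auto simp: GX_def)
    then show False using block[of x y q] q by blast
  qed
  show False
  proof (cases "g = {u, v}")
    case True
    have "path_edges p \<subseteq> {h \<in> G. rk h < rk g}"
    proof
      fix h assume h: "h \<in> path_edges p"
      then have "h \<noteq> g" using p True by (auto simp: is_path_def)
      then show "h \<in> {h \<in> G. rk h < rk g}" using low h by (simp add: C_def)
    qed
    then have "is_path {h \<in> G. rk h < rk g} u v p" using p by (simp add: is_path_def)
    then show False using contra[OF True] len setp by blast
  next
    case False
    then have gp: "g \<in> path_edges p" using g by (simp add: C_def)
    then obtain i where i: "g = {p ! i, p ! Suc i}" "Suc i < length p" by (auto simp: path_edges_def)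
    define x where "x = p ! i"
    define y where "y = p ! Suc i"
    obtain p1 p2 where pp: "p = (p1 @ [x]) @ (y # p2)"
    proof
      have "p = take i p @ x # drop (Suc i) p" unfolding x_def using i by (intro id_take_nth_drop) simp
      also have "drop (Suc i) p = y # drop (Suc (Suc i)) p"
        unfolding y_def using i by (simp add: Cons_nth_drop_Suc)
      finally show "p = (take i p @ [x]) @ (y # drop (Suc (Suc i)) p)" by simp
    qed
    have gxy: "g = {x, y}" using i by (simp add: x_def y_def)
    \<comment> \<open>The cycle without \<open>g\<close>, read from \<open>x\<close> back to
      \<open>u\<close>, over the edge \<open>{u, v}\<close>, and from \<open>v\<close> back to
      \<open>y\<close>.\<close>
    define q where "q = rev (p1 @ [x]) @ rev (y # p2)"
    have d: "distinct (p1 @ [x])" "distinct (y # p2)" "set (p1 @ [x]) \<inter> set (y # p2) = {}"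
      using p unfolding is_path_def pp distinct_append by blast+
    have sC: "successively (\<lambda>a b. {a, b} \<in> C) p" by (subst path_edges_subset_iff[symmetric]) (auto simp: C_def)
    have s1: "successively (\<lambda>a b. {a, b} \<in> C - {g}) (p1 @ [x])"
    proof (rule successively_mono)
      show "successively (\<lambda>a b. {a, b} \<in> C) (p1 @ [x])" using sC by (simp only: pp successively_append_iff)
      show "{a, b} \<in> C - {g}" if "a \<in> set (p1 @ [x])" "b \<in> set (p1 @ [x])" "{a, b} \<in> C" for a b
        using that d(3) unfolding gxy by (auto simp: doubleton_eq_iff)
    qed
    have s2: "successively (\<lambda>a b. {a, b} \<in> C - {g}) (y # p2)"
    proof (rule successively_mono)
      show "successively (\<lambda>a b. {a, b} \<in> C) (y # p2)" using sC by (simp only: pp successively_append_iff)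
      show "{a, b} \<in> C - {g}" if "a \<in> set (y # p2)" "b \<in> set (y # p2)" "{a, b} \<in> C" for a b
        using that d(3) unfolding gxy by (auto simp: doubleton_eq_iff)
    qed
    have ends: "hd (p1 @ [x]) = u" "last (y # p2) = v"
      using p unfolding is_path_def pp by (auto simp: hd_append)
    have link: "{u, v} \<in> C - {g}" using False by (auto simp: C_def)
    have "successively (\<lambda>a b. {a, b} \<in> C - {g}) (rev (p1 @ [x]))"
      "successively (\<lambda>a b. {a, b} \<in> C - {g}) (rev (y # p2))"
      using s1 s2 by (simp_all only: successively_rev insert_commute)
    then have "successively (\<lambda>a b. {a, b} \<in> C - {g}) q"
      unfolding q_def using ends link
      by (subst successively_append_iff) (simp add: last_rev hd_rev del: rev.simps rev_append)
    then have "path_edges q \<subseteq> C - {g}" by (subst path_edges_subset_iff)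
    then have "path_edges q \<subseteq> {h \<in> G. rk h < rk g}" using low by blast
    moreover have "hd q = x" "last q = y" "q \<noteq> []" "distinct q" "set q = set p" "length q = length p"
      using d unfolding q_def pp by auto
    ultimately have "is_path {h \<in> G. rk h < rk g} x y q" by (simp add: is_path_def)
    moreover have "length q \<le> 2 * t" "set q \<subseteq> X"
      using len setp \<open>set q = set p\<close> \<open>length q = length p\<close> by simp_all
    ultimately show False using contra[OF gxy] by blast
  qed
qed

section \<open>The greedy sparsifier\<close>

text \<open>\<open>length\<close> counts vertices: together with an edge between its ends a path
  closes to a cycle of at most \<open>2 * t\<close> edges, the range that
  \<open>short_cycle_free\<close> excludes.\<close>

definition short_path_packing :: "nat \<Rightarrow> edge set \<Rightarrow> nat \<Rightarrow> nat \<Rightarrow> nat list set \<Rightarrow> bool" where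
  "short_path_packing t G u v P \<longleftrightarrow>
     finite P \<and> (\<forall>p\<in>P. is_path G u v p \<and> length p \<le> 2 * t) \<and>
     (\<forall>p\<in>P. \<forall>q\<in>P. p \<noteq> q \<longrightarrow> set p \<inter> set q \<subseteq> {u, v})"

lemma is_path_mono: "is_path G u v p \<Longrightarrow> G \<subseteq> G' \<Longrightarrow> is_path G' u v p"
  by (auto simp: is_path_def)

lemma short_path_packing_mono:
  "short_path_packing t G u v P \<Longrightarrow> G \<subseteq> G' \<Longrightarrow> short_path_packing t G' u v P"
  unfolding short_path_packing_def using is_path_mono by blast

lemma is_path_rev: "is_path G u v p \<Longrightarrow> is_path G v u (rev p)"
  by (auto simp: is_path_iff hd_rev last_rev insert_commute)

text \<open>\<open>S\<close> consists of the inner vertices of a packing that cannot be enlarged. A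
  short path outside the packing must meet one of its paths in an inner vertex, and a path of the
  packing has an inner vertex because \<open>{u, v}\<close> is not an edge.\<close>

lemma exists_hitting_set:
  assumes G: "G \<subseteq> [V]\<^bsup>2\<^esup>" and uv: "u \<in> V" "u \<noteq> v" "{u, v} \<notin> G"
    and no: "\<nexists>P. short_path_packing t G u v P \<and> card P = m"
  shows "\<exists>S \<subseteq> V. S \<inter> {u, v} = {} \<and> card S \<le> m * (2 * t) \<and>
    (\<forall>p. is_path G u v p \<longrightarrow> length p \<le> 2 * t \<longrightarrow> set p \<inter> S \<noteq> {})"
proof -
  define Q where "Q j \<longleftrightarrow> (\<exists>P. short_path_packing t G u v P \<and> card P = j)" for j
  have "Q 0" unfolding Q_def by (intro exI[of _ "{}"]) (simp add: short_path_packing_def)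
  have "\<exists>j<m. Q j \<and> \<not> Q (Suc j)"
  proof (rule ccontr)
    assume a: "\<not> (\<exists>j<m. Q j \<and> \<not> Q (Suc j))"
    have "j \<le> m \<Longrightarrow> Q j" for j by (induction j) (use a \<open>Q 0\<close> in auto)
    then show False using no by (auto simp: Q_def)
  qed
  then obtain j P where j: "j < m" "short_path_packing t G u v P" "card P = j" "\<not> Q (Suc j)"
    by (auto simp: Q_def)
  have P: "finite P" "\<And>p. p \<in> P \<Longrightarrow> is_path G u v p" "\<And>p. p \<in> P \<Longrightarrow> length p \<le> 2 * t"
    "\<And>p q. p \<in> P \<Longrightarrow> q \<in> P \<Longrightarrow> p \<noteq> q \<Longrightarrow> set p \<inter> set q \<subseteq> {u, v}"
    using j(2) unfolding short_path_packing_def by blast+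
  define S where "S = (\<Union>p\<in>P. set p) - {u, v}"
  have "S \<subseteq> V" unfolding S_def using is_path_vertices[OF P(2) G uv(1)] by blast
  moreover have "S \<inter> {u, v} = {}" by (auto simp: S_def)
  moreover have "card S \<le> m * (2 * t)"
  proof -
    have "card S \<le> card (\<Union>p\<in>P. set p)" unfolding S_def using P(1) by (intro card_mono) auto
    also have "\<dots> \<le> (\<Sum>p\<in>P. card (set p))" by (rule card_UN_le[OF P(1)])
    also have "\<dots> \<le> (\<Sum>p\<in>P. 2 * t)"
      using P(3) card_length order_trans by (intro sum_mono) blast
    also have "\<dots> \<le> m * (2 * t)" using j(1,3) by simp
    finally show ?thesis .
  qed
  moreover have "set p \<inter> S \<noteq> {}" if p: "is_path G u v p" "length p \<le> 2 * t" for p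
  proof (cases "p \<in> P")
    case True
    obtain x p' where p': "p = u # x # p'"
      using p(1) uv(2) by (cases p; cases "tl p") (auto simp: is_path_def)
    have "x \<noteq> u" "{u, x} \<in> G" using p(1) by (auto simp: p' is_path_iff)
    then have "x \<notin> {u, v}" using uv(3) by auto
    moreover have "x \<in> set p" using p' by simp
    ultimately have "x \<in> S" using True unfolding S_def by blast
    then show ?thesis using p' by auto
  next
    case False
    have "\<exists>q\<in>P. \<not> set p \<inter> set q \<subseteq> {u, v}"
    proof (rule ccontr)
      assume a: "\<not> (\<exists>q\<in>P. \<not> set p \<inter> set q \<subseteq> {u, v})"
      then have "short_path_packing t G u v (insert p P)"
        unfolding short_path_packing_def using P p by (auto simp: Int_commute)
      moreover have "card (insert p P) = Suc j" using False P(1) j(3) by simp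
      ultimately show False using j(4) unfolding Q_def by blast
    qed
    then show ?thesis by (auto simp: S_def)
  qed
  ultimately show ?thesis by blast
qed

text \<open>The bit length of \<open>c\<close>: class 0 contains only the weight 0, class
  \<open>Suc j\<close> the weights from \<open>2 ^ j\<close> to \<open>2 ^ Suc j - 1\<close>. Free
  edges need a class of their own, since a multiplicative guarantee allows a discarded free edge to
  be replaced only by free ones.\<close>

definition weight_class :: "nat \<Rightarrow> nat" where
  "weight_class c = (LEAST j. c < 2 ^ j)"

lemma less_two_power_weight_class: "c < 2 ^ weight_class c"
  unfolding weight_class_def by (rule LeastI[of _ c]) (rule less_exp)

lemma weight_class_le: "c < 2 ^ j \<Longrightarrow> weight_class c \<le> j"
  unfolding weight_class_def by (rule Least_le)

lemma weight_class_mono: "c \<le> W \<Longrightarrow> weight_class c \<le> weight_class W"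
  using less_two_power_weight_class[of W] by (intro weight_class_le) simp

lemma same_weight_class:
  assumes "weight_class c' = weight_class c"
  shows "c' \<le> 2 * c"
proof (cases "weight_class c")
  case 0
  then show ?thesis using less_two_power_weight_class[of c'] assms by simp
next
  case (Suc j)
  then have "\<not> c < 2 ^ j" using weight_class_le[of c j] by auto
  moreover have "c' < 2 * 2 ^ j" using less_two_power_weight_class[of c'] assms Suc by simp
  ultimately show ?thesis by simp
qed

definition class_edges :: "(edge \<times> nat) list \<Rightarrow> nat \<Rightarrow> edge set" where
  "class_edges s j = {e. \<exists>c. (e, c) \<in> set s \<and> weight_class c = j}"

definition spanned :: "nat \<Rightarrow> nat \<Rightarrow> (edge \<times> nat) list \<Rightarrow> edge \<times> nat \<Rightarrow> bool" where
  "spanned m t s x \<longleftrightarrow> (\<exists>u v P. fst x = {u, v} \<and>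
     short_path_packing t (class_edges s (weight_class (snd x))) u v P \<and> card P = m)"

definition greedy_step :: "nat \<Rightarrow> nat \<Rightarrow> (edge \<times> nat) list \<Rightarrow> edge \<times> nat \<Rightarrow> (edge \<times> nat) list" where
  "greedy_step m t s x = (if spanned m t s x then s else s @ [x])"

definition greedy :: "nat \<Rightarrow> nat \<Rightarrow> (edge \<times> nat) list \<Rightarrow> (edge \<times> nat) list" where
  "greedy m t xs = foldl (greedy_step m t) [] xs"

lemma greedy_snoc: "greedy m t (xs @ [x]) = greedy_step m t (greedy m t xs) x"
  by (simp add: greedy_def)

lemma greedy_Nil [simp]: "greedy m t [] = []"
  by (simp add: greedy_def)

lemma set_greedy_subset: "set (greedy m t xs) \<subseteq> set xs"
  by (induction xs rule: rev_induct) (auto simp: greedy_snoc greedy_step_def)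

lemma distinct_greedy: "distinct (map fst xs) \<Longrightarrow> distinct (map fst (greedy m t xs))"
proof (induction xs rule: rev_induct)
  case (snoc x xs)
  have "fst ` set (greedy m t xs) \<subseteq> fst ` set xs" using set_greedy_subset by blast
  then show ?case using snoc by (auto simp: greedy_snoc greedy_step_def)
qed simp

lemma class_edges_mono: "set s \<subseteq> set s' \<Longrightarrow> class_edges s j \<subseteq> class_edges s' j"
  by (auto simp: class_edges_def)

lemma spanned_mono: "spanned m t s x \<Longrightarrow> set s \<subseteq> set s' \<Longrightarrow> spanned m t s' x"
  unfolding spanned_def using short_path_packing_mono[OF _ class_edges_mono] by blast

text \<open>A packing found on arrival survives because stored edges are never removed.\<close>

lemma greedy_spans: "x \<in> set xs \<Longrightarrow> x \<notin> set (greedy m t xs) \<Longrightarrow> spanned m t (greedy m t xs) x"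
proof (induction xs rule: rev_induct)
  case (snoc y xs)
  have sub: "set (greedy m t xs) \<subseteq> set (greedy m t (xs @ [y]))"
    by (auto simp: greedy_snoc greedy_step_def)
  show ?case
  proof (cases "x \<in> set xs")
    case True
    then have "spanned m t (greedy m t xs) x" using snoc sub by blast
    then show ?thesis using sub by (rule spanned_mono)
  next
    case False
    then have "x = y" using snoc.prems by simp
    then show ?thesis using snoc.prems by (auto simp: greedy_snoc greedy_step_def split: if_splits)
  qed
qed simp

text \<open>The list keeps the order of insertion, so its first \<open>i\<close> entries are the
  ones against which entry \<open>i\<close> was tested.\<close>

lemma greedy_not_spanned:
  "i < length (greedy m t xs) \<Longrightarrow> \<not> spanned m t (take i (greedy m t xs)) (greedy m t xs ! i)"
proof (induction xs rule: rev_induct)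
  case (snoc y xs)
  then show ?case
    by (cases "i < length (greedy m t xs)")
      (auto simp: greedy_snoc greedy_step_def nth_append less_Suc_eq split: if_splits)
qed simp

lemma greedy_class_size:
  assumes n: "n \<ge> 2" and t: "t \<ge> 1" and m: "m \<ge> 1"
    and dis: "distinct (map fst xs)" and V: "fst ` set xs \<subseteq> [{..<n}]\<^bsup>2\<^esup>"
  shows "real (card (class_edges (greedy m t xs) j))
    \<le> 8 * (2 * real (m * (2 * t))) powr (1 - 1 / real t) * real n powr (1 + 1 / real t)"
proof -
  define s where "s = greedy m t xs"
  define G where "G = class_edges s j"
  have ds: "distinct (map fst s)" unfolding s_def by (rule distinct_greedy[OF dis])
  have sV: "fst ` set s \<subseteq> [{..<n}]\<^bsup>2\<^esup>" using set_greedy_subset V unfolding s_def by blast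
  have GV: "G \<subseteq> [{..<n}]\<^bsup>2\<^esup>"
  proof
    fix e assume "e \<in> G"
    then obtain c where "(e, c) \<in> set s" unfolding G_def class_edges_def by blast
    then have "e \<in> fst ` set s" by (rule image_eqI[rotated]) simp
    then show "e \<in> [{..<n}]\<^bsup>2\<^esup>" using sV by blast
  qed
  have "\<exists>i. i < length s \<and> fst (s ! i) = e \<and> weight_class (snd (s ! i)) = j" if "e \<in> G" for e
    using that by (fastforce simp: G_def class_edges_def in_set_conv_nth)
  \<comment> \<open>Positions in the whole stored list serve as insertion order; within one class
    they need not be consecutive.\<close>
  then obtain rk where rk: "\<And>e. e \<in> G \<Longrightarrow> rk e < length s" "\<And>e. e \<in> G \<Longrightarrow> fst (s ! rk e) = e"
    "\<And>e. e \<in> G \<Longrightarrow> weight_class (snd (s ! rk e)) = j" by metis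
  have rinj: "inj_on rk G" by (rule inj_onI) (metis rk(2))
  have low: "{g \<in> G. rk g < rk e} \<subseteq> class_edges (take (rk e) s) j" if e: "e \<in> G" for e
  proof
    fix g assume g: "g \<in> {g \<in> G. rk g < rk e}"
    then have gG: "g \<in> G" "rk g < rk e" by auto
    then have "s ! rk g \<in> set (take (rk e) s)" using rk(1)[OF e]
      by (auto simp: in_set_conv_nth intro!: exI[of _ "rk g"])
    moreover have "s ! rk g = (g, snd (s ! rk g))" using rk(2)[OF gG(1)] by (simp add: prod_eq_iff)
    ultimately have "(g, snd (s ! rk g)) \<in> set (take (rk e) s)" by simp
    then show "g \<in> class_edges (take (rk e) s) j" using rk(3)[OF gG(1)]
      unfolding class_edges_def by blast
  qed
  define blocks where "blocks e S \<longleftrightarrow> S \<subseteq> {..<n} \<and> S \<inter> e = {} \<and> card S \<le> m * (2 * t) \<and>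
      (\<forall>u v p. e = {u, v} \<longrightarrow> is_path {g \<in> G. rk g < rk e} u v p \<longrightarrow> length p \<le> 2 * t \<longrightarrow>
        set p \<inter> S \<noteq> {})" for e S
  have "\<exists>S. blocks e S" if e: "e \<in> G" for e
  proof -
    let ?G = "class_edges (take (rk e) s) j"
    obtain a b where ab: "e = {a, b}" "a < n" "b < n" "a \<noteq> b"
    proof -
      have "e \<in> [{..<n}]\<^bsup>2\<^esup>" using GV e by blast
      then show thesis by (rule nsets2_E) (auto intro: that)
    qed
    have "e \<notin> ?G"
    proof
      assume "e \<in> ?G"
      then obtain c where "(e, c) \<in> set (take (rk e) s)" by (auto simp: class_edges_def)
      then obtain i where i: "i < rk e" "i < length s" "s ! i = (e, c)" by (auto simp: in_set_conv_nth)
      then have "map fst s ! i = map fst s ! rk e" using rk[OF e] by simp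
      then have "i = rk e"
        using nth_eq_iff_index_eq[OF ds] i(2) rk(1)[OF e] by (metis length_map)
      then show False using i(1) by simp
    qed
    have sub: "?G \<subseteq> [{..<n}]\<^bsup>2\<^esup>"
    proof
      fix g assume "g \<in> ?G"
      then obtain c where "(g, c) \<in> set (take (rk e) s)" unfolding class_edges_def by blast
      then have "(g, c) \<in> set s" by (rule in_set_takeD)
      then have "g \<in> fst ` set s" by (rule image_eqI[rotated]) simp
      then show "g \<in> [{..<n}]\<^bsup>2\<^esup>" using sV by blast
    qed
    have ns: "\<not> spanned m t (take (rk e) s) (s ! rk e)"
      using greedy_not_spanned rk(1)[OF e] unfolding s_def by blast
    have "\<nexists>P. short_path_packing t ?G a b P \<and> card P = m"
      using ns rk(2,3)[OF e] ab(1) unfolding spanned_def by auto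
    then obtain S where S: "S \<subseteq> {..<n}" "S \<inter> {a, b} = {}" "card S \<le> m * (2 * t)"
      "\<forall>p. is_path ?G a b p \<longrightarrow> length p \<le> 2 * t \<longrightarrow> set p \<inter> S \<noteq> {}"
      using exists_hitting_set[OF sub _ ab(4), of t m] ab(1,2) \<open>e \<notin> ?G\<close> by auto
    have "set p \<inter> S \<noteq> {}"
      if "e = {u, v}" "is_path {g \<in> G. rk g < rk e} u v p" "length p \<le> 2 * t" for u v p
    proof -
      have p: "is_path ?G u v p" using that(2) low[OF e] by (rule is_path_mono)
      \<comment> \<open>An edge does not distinguish its ends, while \<open>S\<close> was built for
        paths from \<open>a\<close> to \<open>b\<close>; paths in the other direction are read
        backwards.\<close>
      have "u = a \<and> v = b \<or> u = b \<and> v = a" using that(1) ab(1) by (auto simp: doubleton_eq_iff)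
      then show ?thesis
      proof (elim disjE)
        assume "u = a \<and> v = b"
        then show ?thesis using S(4) p that(3) by blast
      next
        assume "u = b \<and> v = a"
        then have "is_path ?G a b (rev p)" using is_path_rev[OF p] by simp
        then have "set (rev p) \<inter> S \<noteq> {}" using S(4) that(3) by (metis length_rev)
        then show ?thesis by simp
      qed
    qed
    then show ?thesis using S(1-3) ab(1) unfolding blocks_def by (intro exI[of _ S]) simp
  qed
  then have "\<forall>e\<in>G. \<exists>S. blocks e S" by blast
  from bchoice[OF this] obtain Z where Z: "\<forall>e\<in>G. blocks e (Z e)" ..
  have "real (card G) \<le> 8 * (2 * real (m * (2 * t))) powr (1 - 1 / real t) * real n powr (1 + 1 / real t)"
  proof (rule blocked_graph_size[of "{..<n}" n G t "m * (2 * t)" Z])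
    show "short_cycle_free t {e \<in> G. e \<subseteq> X \<and> Z e \<inter> X = {}}" for X
      by (rule blocked_greedy_short_cycle_free[OF GV rinj]) (use Z in \<open>simp add: blocks_def\<close>)
    show "Z e \<subseteq> {..<n} \<and> Z e \<inter> e = {} \<and> card (Z e) \<le> m * (2 * t)" if "e \<in> G" for e
      using bspec[OF Z that] by (simp add: blocks_def)
  qed (use n t m GV in auto)
  then show ?thesis by (simp add: G_def s_def)
qed

lemma length_greedy_le:
  assumes "n \<ge> 2" "t \<ge> 1" "m \<ge> 1" "distinct (map fst xs)" "fst ` set xs \<subseteq> [{..<n}]\<^bsup>2\<^esup>"
    and W: "\<And>x. x \<in> set xs \<Longrightarrow> snd x \<le> W"
  shows "real (length (greedy m t xs)) \<le> real (Suc (weight_class W)) *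
    (8 * (2 * real (m * (2 * t))) powr (1 - 1 / real t) * real n powr (1 + 1 / real t))"
    (is "_ \<le> _ * ?B")
proof -
  define s where "s = greedy m t xs"
  have "length s = card (fst ` set s)"
    using distinct_card[OF distinct_greedy[OF assms(4), of m t]] by (simp add: s_def)
  also have "\<dots> \<le> card (\<Union>j\<in>{..weight_class W}. class_edges s j)"
  proof (rule card_mono)
    have "class_edges s j \<subseteq> fst ` set s" for j by (force simp: class_edges_def)
    then have "finite (class_edges s j)" for j by (meson finite_imageI finite_set finite_subset)
    then show "finite (\<Union>j\<in>{..weight_class W}. class_edges s j)" by simp
    show "fst ` set s \<subseteq> (\<Union>j\<in>{..weight_class W}. class_edges s j)"
    proof (rule image_subsetI)
      fix x assume x: "x \<in> set s"
      then have "x \<in> set xs" using set_greedy_subset s_def by blast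
      then have "weight_class (snd x) \<le> weight_class W" by (intro weight_class_mono W)
      moreover have "fst x \<in> class_edges s (weight_class (snd x))"
        using x by (auto simp: class_edges_def intro!: exI[of _ "snd x"])
      ultimately show "fst x \<in> (\<Union>j\<in>{..weight_class W}. class_edges s j)" by blast
    qed
  qed
  also have "\<dots> \<le> (\<Sum>j\<le>weight_class W. card (class_edges s j))" by (rule card_UN_le) simp
  finally have "real (length s) \<le> (\<Sum>j\<le>weight_class W. real (card (class_edges s j)))"
    by (metis of_nat_le_iff of_nat_sum)
  also have "\<dots> \<le> (\<Sum>j\<le>weight_class W. ?B)"
    using greedy_class_size[OF assms(1-5)] unfolding s_def by (intro sum_mono)
  finally show ?thesis by (simp add: s_def)
qed

text \<open>For \<open>k = 0\<close> the space bound is 0, as \<open>0 powr x = 0\<close> for every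
  \<open>x\<close>, so the memory has to stay empty. It does: the empty packing already spans every
  edge.\<close>

lemma greedy_no_paths: "(\<And>x. x \<in> set xs \<Longrightarrow> fst x \<in> [V]\<^bsup>2\<^esup>) \<Longrightarrow> greedy 0 t xs = []"
proof (induction xs rule: rev_induct)
  case (snoc x xs)
  have "fst x \<in> [V]\<^bsup>2\<^esup>" using snoc.prems by simp
  then obtain u v where "fst x = {u, v}" by (rule nsets2_E)
  then have "spanned 0 t s x" for s
    unfolding spanned_def
    by (intro exI[of _ u] exI[of _ v] exI[of _ "{}"]) (simp add: short_path_packing_def)
  then show ?case using snoc by (simp add: greedy_snoc greedy_step_def)
qed simp

text \<open>Induction on the number of edges of \<open>F\<close> outside \<open>H\<close>. An
  exchange adds only edges of \<open>H\<close>, so this number drops, and the weight inside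
  \<open>H\<close> grows by at most \<open>8 * t\<close> times the weight of the removed
  edge.\<close>

lemma greedy_exchange:
  fixes w :: "edge \<Rightarrow> nat"
  assumes V: "finite V" "E \<subseteq> [V]\<^bsup>2\<^esup>" "R \<subseteq> V" and es: "set es = E"
    and k: "k > 0" "\<And>a b. a \<in> R \<Longrightarrow> b \<in> R \<Longrightarrow> a \<noteq> b \<Longrightarrow> r {a, b} \<le> k" and t: "t \<ge> 1"
    and H: "H = fst ` set (greedy (2 * k) t (map (\<lambda>e. (e, w e)) es))"
    and F: "F \<subseteq> E" "cut_feasible V R r F"
  shows "\<exists>F' \<subseteq> H. cut_feasible V R r F' \<and> sum w F' \<le> sum w (F \<inter> H) + 8 * t * sum w (F - H)"
  using F
proof (induction "card (F - H)" arbitrary: F)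
  define s where "s = greedy (2 * k) t (map (\<lambda>e. (e, w e)) es)"
  have finE: "finite E" using V by (meson finite_imp_finite_nsets finite_subset)
  have sw: "c = w e \<and> e \<in> E" if "(e, c) \<in> set s" for e c
    using that set_greedy_subset[of "2 * k" t "map (\<lambda>e. (e, w e)) es"] es by (auto simp: s_def)
  have HE: "H \<subseteq> E" using sw by (force simp: H s_def[symmetric])
  {
    case 0
    then have "F - H = {}" using finE finite_subset by (metis card_0_eq finite_Diff)
    then have "F \<subseteq> H" "F \<inter> H = F" by auto
    then show ?case using 0 by auto
  next
    case (Suc m)
    have finF: "finite F" using Suc.prems finE finite_subset by blast
    obtain e where e: "e \<in> F" "e \<notin> H" using Suc.hyps(2) by (metis Diff_iff card.empty all_not_in_conv nat.distinct(1))
    have "(e, w e) \<in> set (map (\<lambda>e. (e, w e)) es)" using e Suc.prems(1) es by auto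
    moreover have "(e, w e) \<notin> set s" using e(2) by (force simp: H s_def)
    ultimately have "spanned (2 * k) t s (e, w e)" unfolding s_def by (rule greedy_spans)
    then obtain u v P where P: "e = {u, v}"
      "short_path_packing t (class_edges s (weight_class (w e))) u v P" "card P = 2 * k"
      by (auto simp: spanned_def)
    have "{u, v} \<in> [V]\<^bsup>2\<^esup>" using e(1) P(1) Suc.prems(1) V(2) by blast
    then have uv: "u \<noteq> v" by simp
    have cH: "class_edges s j \<subseteq> H" for j by (force simp: class_edges_def H s_def)
    \<comment> \<open>Each path has fewer than \<open>2 * t\<close> edges, each at most twice as
      heavy as \<open>e\<close>. This allows the value \<open>4 * t * w e\<close> for the path cost
      \<open>T\<close>, which the exchange doubles.\<close>
    have "\<exists>Q \<subseteq> H. cut_feasible V R r ((F - {{u, v}}) \<union> Q) \<and> sum w Q \<le> 2 * (4 * t * w e)"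
    proof (rule exchange_edge[OF V(1) _ _ Suc.prems(2) k(1) _ _ _ uv _ P(3)])
      show "F \<subseteq> [V]\<^bsup>2\<^esup>" "H \<subseteq> [V]\<^bsup>2\<^esup>" using Suc.prems(1) HE V(2) by blast+
      show "{u, v} \<in> F" "{u, v} \<notin> H" using e P(1) by auto
      show "finite P" using P(2) by (simp add: short_path_packing_def)
      show "set p \<inter> set q \<subseteq> {u, v}" if "p \<in> P" "q \<in> P" "p \<noteq> q" for p q
        using P(2) that by (simp add: short_path_packing_def)
      fix p assume "p \<in> P"
      then have p: "is_path (class_edges s (weight_class (w e))) u v p" "length p \<le> 2 * t"
        using P(2) by (auto simp: short_path_packing_def)
      show "is_path H u v p" using p(1) cH by (rule is_path_mono)
      have "w {x, y} \<le> 2 * w e" if xy: "(x, y) \<in> arcs p" for x y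
      proof -
        have "{x, y} \<in> path_edges p" using xy by (force simp: path_edges_arcs)
        then have "{x, y} \<in> class_edges s (weight_class (w e))" using p(1) by (auto simp: is_path_def)
        then show ?thesis using sw same_weight_class by (auto simp: class_edges_def)
      qed
      then have "(\<Sum>(x, y)\<in>arcs p. w {x, y}) \<le> (\<Sum>z\<in>arcs p. 2 * w e)" by (intro sum_mono) auto
      also have "\<dots> = card (arcs p) * (2 * w e)" by simp
      also have "\<dots> \<le> (2 * t) * (2 * w e)" using card_arcs_le[of p] p(2) by (intro mult_right_mono) auto
      finally show "(\<Sum>(x, y)\<in>arcs p. w {x, y}) \<le> 4 * t * w e" by (simp add: algebra_simps)
    qed (rule k(2))
    then obtain Q where Q: "Q \<subseteq> H" "cut_feasible V R r ((F - {e}) \<union> Q)" "sum w Q \<le> 8 * t * w e"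
      using P(1) by auto
    let ?F = "(F - {e}) \<union> Q"
    have finQ: "finite Q" using Q(1) HE finE by (meson finite_subset)
    have dH: "?F - H = (F - H) - {e}" and iH: "?F \<inter> H = (F \<inter> H) \<union> Q" using Q(1) e(2) by auto
    have "m = card (?F - H)" unfolding dH using Suc.hyps(2) e by simp
    moreover have "?F \<subseteq> E" using Suc.prems(1) Q(1) HE by blast
    ultimately obtain F' where F': "F' \<subseteq> H" "cut_feasible V R r F'"
      "sum w F' \<le> sum w (?F \<inter> H) + 8 * t * sum w (?F - H)"
      using Suc.hyps(1)[of ?F] Q(2) by blast
    have "sum w (?F \<inter> H) \<le> sum w (F \<inter> H) + sum w Q"
      unfolding iH using finF finQ by (simp add: sum_Un_nat)
    moreover have "sum w (F - H) = w e + sum w (?F - H)"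
      unfolding dH using finF e by (intro sum.remove) auto
    ultimately have "sum w F' \<le> sum w (F \<inter> H) + 8 * t * sum w (F - H)"
      using F'(3) Q(3) by (simp add: algebra_simps)
    then show ?case using F' by blast
  }
qed

section \<open>The streaming algorithm\<close>

definition stream_items :: "nat \<Rightarrow> nat \<Rightarrow> (edge \<times> nat) set" where
  "stream_items n W = [{..<n}]\<^bsup>2\<^esup> \<times> {0..W}"

text \<open>The number of base-\<open>n\<close> digits that suffice for every weight up to
  \<open>W\<close>.\<close>

definition weight_words :: "nat \<Rightarrow> nat \<Rightarrow> nat" where
  "weight_words n W = (LEAST l. W < n ^ l)"

lemma less_power_weight_words:
  assumes "n \<ge> 2"
  shows "W < n ^ weight_words n W"
  unfolding weight_words_def
proof (rule LeastI)
  have "W < 2 ^ W" by (rule less_exp)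
  also have "\<dots> \<le> n ^ W" using assms by (rule power_mono) simp
  finally show "W < n ^ W" .
qed

text \<open>Fixed-length codes exist for counting reasons; since computation is unrestricted,
  no explicit code is needed.\<close>

definition item_code :: "nat \<Rightarrow> nat \<Rightarrow> edge \<times> nat \<Rightarrow> nat list" where
  "item_code n W = (SOME g. inj_on g (stream_items n W) \<and>
     g ` stream_items n W \<subseteq> {ys. set ys \<subseteq> {..<n} \<and> length ys = 2 + weight_words n W})"

lemma item_code:
  assumes "n \<ge> 2"
  shows "inj_on (item_code n W) (stream_items n W)"
    and "x \<in> stream_items n W \<Longrightarrow> set (item_code n W x) \<subseteq> {..<n}"
    and "x \<in> stream_items n W \<Longrightarrow> length (item_code n W x) = 2 + weight_words n W"
proof -
  let ?B = "{ys. set ys \<subseteq> {..<n} \<and> length ys = 2 + weight_words n W}"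
  have "card (stream_items n W) = (n choose 2) * Suc W" by (simp add: stream_items_def card_cartesian_product)
  also have "\<dots> \<le> n ^ 2 * n ^ weight_words n W"
  proof (rule mult_mono)
    show "n choose 2 \<le> n ^ 2" using assms by (intro binomial_le_pow) auto
  qed (use less_power_weight_words[OF assms, of W] in auto)
  also have "\<dots> = card ?B" by (simp only: card_lists_length_eq finite_lessThan card_lessThan power_add)
  finally have le: "card (stream_items n W) \<le> card ?B" .
  have fin: "finite (stream_items n W)" "finite ?B"
    by (simp_all add: stream_items_def finite_imp_finite_nsets finite_lists_length_eq)
  obtain g where "g ` stream_items n W \<subseteq> ?B" "inj_on g (stream_items n W)"
    using card_le_inj[OF fin le] by (elim exE conjE) (rule that)
  then have "\<exists>g. inj_on g (stream_items n W) \<and> g ` stream_items n W \<subseteq> ?B"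
    by (intro exI[of _ g] conjI)
  from someI_ex[OF this] have "inj_on (item_code n W) (stream_items n W) \<and> item_code n W ` stream_items n W \<subseteq> ?B"
    unfolding item_code_def .
  then have inj: "inj_on (item_code n W) (stream_items n W)"
    and im: "item_code n W ` stream_items n W \<subseteq> ?B" by (rule conjunct1, rule conjunct2)
  have "item_code n W x \<in> ?B" if "x \<in> stream_items n W" for x
    using subsetD[OF im imageI[OF that]] .
  with inj show "inj_on (item_code n W) (stream_items n W)"
    "x \<in> stream_items n W \<Longrightarrow> set (item_code n W x) \<subseteq> {..<n}"
    "x \<in> stream_items n W \<Longrightarrow> length (item_code n W x) = 2 + weight_words n W" by auto
qed

definition encode :: "nat \<Rightarrow> nat \<Rightarrow> (edge \<times> nat) list \<Rightarrow> nat list" where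
  "encode n W s = concat (map (item_code n W) s)"

definition decode :: "nat \<Rightarrow> nat \<Rightarrow> nat list \<Rightarrow> (edge \<times> nat) list" where
  "decode n W = inv_into (lists (stream_items n W)) (encode n W)"

text \<open>Blocks of one common length are read off uniquely; positive length makes the number of
  blocks recoverable.\<close>

lemma inj_on_concat_map:
  assumes "inj_on g I" "\<And>x. x \<in> I \<Longrightarrow> length (g x) = l" "l > 0"
  shows "inj_on (\<lambda>s. concat (map g s)) (lists I)"
proof (rule inj_onI)
  fix s s' assume "s \<in> lists I" "s' \<in> lists I" "concat (map g s) = concat (map g s')"
  then show "s = s'"
  proof (induction s arbitrary: s' rule: list.induct)
    case Nil
    then show ?case using assms(2,3) by (cases s') auto
  next
    case (Cons x s)
    note prems = Cons.prems and IH = Cons.IH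
    have x: "x \<in> I" using prems(1) by simp
    show ?case
    proof (cases s')
      case Nil
      then have "g x = []" using prems(3) by simp
      then show ?thesis using assms(2)[OF x] assms(3) by simp
    next
      case (Cons y s'')
      have y: "y \<in> I" using prems(2) Cons by simp
      have "g x @ concat (map g s) = g y @ concat (map g s'')" using prems(3) Cons by simp
      then have "g x = g y \<and> concat (map g s) = concat (map g s'')"
        using assms(2)[OF x] assms(2)[OF y] by (simp add: append_eq_append_conv)
      then show ?thesis using assms(1) x y IH[of s''] prems Cons by (auto simp: inj_on_def)
    qed
  qed
qed

lemma decode_encode:
  assumes "n \<ge> 2" "set s \<subseteq> stream_items n W"
  shows "decode n W (encode n W s) = s"
proof -
  have "inj_on (encode n W) (lists (stream_items n W))"
    unfolding encode_def using item_code(1)[OF assms(1), of W] item_code(3)[OF assms(1), of _ W]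
    by (intro inj_on_concat_map[where l = "2 + weight_words n W"]) auto
  then show ?thesis unfolding decode_def using assms(2) by (intro inv_into_f_f) auto
qed

lemma set_encode:
  assumes "n \<ge> 2" "set s \<subseteq> stream_items n W"
  shows "set (encode n W s) \<subseteq> {..<n}"
  using item_code(2)[OF assms(1), of _ W] assms(2) by (fastforce simp: encode_def)

lemma length_encode:
  assumes "n \<ge> 2" "set s \<subseteq> stream_items n W"
  shows "length (encode n W s) = (2 + weight_words n W) * length s"
  using assms(2) by (induction s) (auto simp: encode_def item_code(3)[OF assms(1)])

text \<open>The output is an exact optimum of the stored graph, which unrestricted computation
  permits; any cheap feasible subgraph of the stored edges then bounds its weight. The weights are
  kept with the edges because the output sees only the memory.\<close>

definition elc_algorithm :: elc_streaming_algorithm where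
  "elc_algorithm n R r W t =
     \<lparr>initial = [],
      update = \<lambda>mem x. encode n W (greedy_step (2 * max_requirement R r) t (decode n W mem) x),
      result = \<lambda>mem. let s = decode n W mem in
        SOME F. is_arg_min (sum (\<lambda>e. the (map_of s e))) (elc_feasible (fst ` set s) R r) F\<rparr>"

lemma memory_after_elc_algorithm:
  assumes "n \<ge> 2" "set xs \<subseteq> stream_items n W"
  shows "memory_after (elc_algorithm n R r W t) xs
    = encode n W (greedy (2 * max_requirement R r) t xs)"
  using assms(2)
proof (induction xs rule: rev_induct)
  case Nil
  then show ?case by (simp add: memory_after_def elc_algorithm_def encode_def)
next
  case (snoc x xs)
  have "set (greedy (2 * max_requirement R r) t xs) \<subseteq> stream_items n W"
    using set_greedy_subset snoc.prems by fastforce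
  note dec = decode_encode[OF assms(1) this]
  have "memory_after (elc_algorithm n R r W t) (xs @ [x])
      = update (elc_algorithm n R r W t) (memory_after (elc_algorithm n R r W t) xs) x"
    by (simp add: memory_after_def)
  also have "\<dots> = encode n W (greedy (2 * max_requirement R r) t (xs @ [x]))"
    using snoc dec by (simp add: elc_algorithm_def greedy_snoc)
  finally show ?case .
qed

lemma requirement_le_max:
  assumes "finite R" "a \<in> R" "b \<in> R" "a \<noteq> b"
  shows "r {a, b} \<le> max_requirement R r"
  unfolding max_requirement_def using assms
  by (intro Max_ge) (auto simp: finite_imp_finite_nsets)

lemma elc_algorithm_approximates:
  assumes n: "n \<ge> 2" and R: "R \<subseteq> {..<n}" and E: "E \<subseteq> [{..<n}]\<^bsup>2\<^esup>" and w: "w \<in> E \<rightarrow> {0..W}"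
    and es: "distinct es" "set es = E" and t: "t \<ge> 1" and feas: "\<exists>F. elc_feasible E R r F"
  shows "elc_approximate (8 * real t) E w R r
    (output_on (elc_algorithm n R r W t) (map (\<lambda>e. (e, w e)) es))"
proof -
  let ?V = "{..<n}"
  define k where "k = max_requirement R r"
  define xs where "xs = map (\<lambda>e. (e, w e)) es"
  define s where "s = greedy (2 * k) t xs"
  define H where "H = fst ` set s"
  define w' where "w' e = the (map_of s e)" for e
  have finE: "finite E" using es by auto
  have xsI: "set xs \<subseteq> stream_items n W" using es E w by (auto simp: xs_def stream_items_def Pi_def)
  have sI: "set s \<subseteq> stream_items n W" using xsI set_greedy_subset unfolding s_def by blast
  have sxs: "set s \<subseteq> set xs" unfolding s_def by (rule set_greedy_subset)
  have HE: "H \<subseteq> E" using sxs es by (auto simp: H_def xs_def)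
  \<comment> \<open>The weights recovered from the memory are the true ones on the stored
    edges.\<close>
  have ww: "w' e = w e" if "e \<in> H" for e
  proof -
    have "map_of s e \<noteq> None" using that by (simp add: H_def map_of_eq_None_iff)
    then obtain c where c: "map_of s e = Some c" by blast
    have "(e, c) \<in> set xs" by (rule subsetD[OF sxs map_of_SomeD[OF c]])
    then have "c = w e" unfolding xs_def by auto
    then show ?thesis by (simp add: w'_def c)
  qed
  have out: "output_on (elc_algorithm n R r W t) xs = (SOME F. is_arg_min (sum w') (elc_feasible H R r) F)"
  proof -
    have mem: "memory_after (elc_algorithm n R r W t) xs = encode n W s"
      unfolding s_def k_def by (rule memory_after_elc_algorithm[OF n xsI])
    have w'eq: "w' = (\<lambda>e. the (map_of s e))" by (rule ext) (rule w'_def)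
    show ?thesis unfolding output_on_def mem w'eq H_def
      by (simp add: elc_algorithm_def decode_encode[OF n sI])
  qed
  obtain F0 where F0: "elc_feasible E R r F0" "sum w F0 = elc_opt E w R r"
  proof -
    have "{F. elc_feasible E R r F} \<subseteq> Pow E" by (auto simp: elc_feasible_def)
    then have "finite {F. elc_feasible E R r F}" using finE by (meson finite_Pow_iff finite_subset)
    then have "elc_opt E w R r \<in> sum w ` {F. elc_feasible E R r F}"
      unfolding elc_opt_def using feas by (intro Min_in) auto
    then show thesis using that by auto
  qed
  have F0E: "F0 \<subseteq> E" using F0 by (simp add: elc_feasible_def)
  have "\<exists>F' \<subseteq> H. cut_feasible ?V R r F' \<and> sum w F' \<le> 8 * t * sum w F0"
  proof (cases "k = 0")
    case True
    have "r {a, b} = 0" if "a \<in> R" "b \<in> R" "a \<noteq> b" for a b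
      using requirement_le_max[of R a b r] finite_subset[OF R] that True by (simp add: k_def)
    then have zero: "r {a, b} = 0" if "setpair ?V R A B" "a \<in> A \<inter> R" "b \<in> B \<inter> R" for A B a b
      using that setpair_disjoint by blast
    have "cut_feasible ?V R r {}" unfolding cut_feasible_def by (simp add: zero)
    then show ?thesis by (intro exI[of _ "{}"]) simp
  next
    case False
    have "cut_feasible ?V R r F0"
      using F0(1) elc_feasible_iff_cut_feasible[OF _ E R F0E] by simp
    moreover have "r {a, b} \<le> k" if "a \<in> R" "b \<in> R" "a \<noteq> b" for a b
      unfolding k_def using finite_subset[OF R] that by (intro requirement_le_max) simp_all
    moreover have "H = fst ` set (greedy (2 * k) t (map (\<lambda>e. (e, w e)) es))"
      by (simp only: H_def s_def xs_def)
    ultimately have "\<exists>F' \<subseteq> H. cut_feasible ?V R r F' \<and>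
        sum w F' \<le> sum w (F0 \<inter> H) + 8 * t * sum w (F0 - H)"
      using False by (intro greedy_exchange[OF finite_lessThan E R es(2) _ _ t _ F0E]) auto
    then obtain F' where F': "F' \<subseteq> H" "cut_feasible ?V R r F'"
      "sum w F' \<le> sum w (F0 \<inter> H) + 8 * t * sum w (F0 - H)" by blast
    have "sum w F0 = sum w (F0 \<inter> H) + sum w (F0 - H)"
      using F0E finE by (metis finite_subset sum.Int_Diff)
    then have "8 * t * sum w F0 = 8 * t * sum w (F0 \<inter> H) + 8 * t * sum w (F0 - H)"
      by (simp only: add_mult_distrib2)
    moreover have "sum w (F0 \<inter> H) \<le> 8 * t * sum w (F0 \<inter> H)" using t by simp
    ultimately have "sum w F' \<le> 8 * t * sum w F0" using F'(3) by linarith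
    then show ?thesis using F' by blast
  qed
  then obtain F' where F': "F' \<subseteq> H" "cut_feasible ?V R r F'" "sum w F' \<le> 8 * t * sum w F0" by blast
  have HV: "H \<subseteq> [?V]\<^bsup>2\<^esup>" using HE E by blast
  have F'f: "elc_feasible H R r F'" using F' elc_feasible_iff_cut_feasible[OF _ HV R F'(1)] by simp
  have "{F. elc_feasible H R r F} \<subseteq> Pow H" by (auto simp: elc_feasible_def)
  then have "finite {F. elc_feasible H R r F}"
    using finite_subset[OF HE finE] by (meson finite_Pow_iff finite_subset)
  \<comment> \<open>\<open>F'\<close> witnesses that the stored graph is feasible, so the choice in
    \<open>result\<close> is a genuine minimum and costs no more than \<open>F'\<close>.\<close>
  then have "\<exists>F. is_arg_min (sum w') (elc_feasible H R r) F"
    using ex_is_arg_min_if_finite[of "{F. elc_feasible H R r F}" "sum w'"] F'f by auto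
  from someI_ex[OF this] obtain F where F: "output_on (elc_algorithm n R r W t) xs = F"
    "is_arg_min (sum w') (elc_feasible H R r) F" using out by blast
  have FH: "elc_feasible H R r F" "sum w' F \<le> sum w' F'"
    using F(2) F'f unfolding is_arg_min_def by (auto simp: not_less)
  have "F \<subseteq> H" using FH(1) by (simp add: elc_feasible_def)
  then have "sum w' F = sum w F" "sum w' F' = sum w F'" using F'(1) ww by (auto intro!: sum.cong)
  then have "sum w F \<le> 8 * t * elc_opt E w R r" using FH(2) F'(3) F0(2) by simp
  then have "real (sum w F) \<le> real (8 * t * elc_opt E w R r)" by (rule of_nat_mono)
  moreover have "elc_feasible E R r F" using FH(1) HE unfolding elc_feasible_def by blast
  ultimately show ?thesis using F(1) by (simp add: elc_approximate_def xs_def)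
qed

section \<open>Arithmetic of the space bound\<close>

lemma less_power_floor:
  assumes "real W \<le> B powr x" "B > 1" "x \<ge> 0"
  shows "real W < B ^ (nat \<lfloor>x\<rfloor> + 1)"
proof -
  have "x < real (nat \<lfloor>x\<rfloor> + 1)" using assms(3) by linarith
  then have "B powr x < B powr real (nat \<lfloor>x\<rfloor> + 1)" using assms(2) by (intro powr_less_mono)
  also have "\<dots> = B ^ (nat \<lfloor>x\<rfloor> + 1)" using assms(2) by (intro powr_realpow) simp
  finally show ?thesis using assms(1) by simp
qed

text \<open>Since the logarithm is at least 1, rounding and additive constants are absorbed by its
  power; the absolute value covers a negative \<open>b\<close>.\<close>

lemma weight_words_le:
  assumes n: "n \<ge> 2" and W: "real W \<le> real n powr (b * log 2 (real n) ^ a)"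
  shows "real (2 + weight_words n W) \<le> (3 + \<bar>b\<bar>) * log 2 (real n) ^ a"
proof -
  define L where "L = log 2 (real n)"
  have L: "L \<ge> 1" using n by (simp add: L_def)
  have La: "L ^ a \<ge> 1" using L by simp
  let ?x = "\<bar>b\<bar> * L ^ a"
  have x0: "?x \<ge> 0" using L by simp
  have "real W \<le> real n powr ?x"
  proof -
    have "b * L ^ a \<le> ?x" using La by (intro mult_right_mono) auto
    then have "real n powr (b * L ^ a) \<le> real n powr ?x" using n by (intro powr_mono) auto
    then show ?thesis using W by (simp add: L_def)
  qed
  then have "real W < real n ^ (nat \<lfloor>?x\<rfloor> + 1)" using n x0 by (intro less_power_floor) auto
  then have "W < n ^ (nat \<lfloor>?x\<rfloor> + 1)" by (metis of_nat_less_iff of_nat_power)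
  then have "weight_words n W \<le> nat \<lfloor>?x\<rfloor> + 1" unfolding weight_words_def by (rule Least_le)
  then have "real (weight_words n W) \<le> ?x + 1" using x0 by linarith
  then have "real (2 + weight_words n W) \<le> 3 * 1 + ?x" by simp
  also have "\<dots> \<le> 3 * L ^ a + ?x" using La by linarith
  finally show ?thesis by (simp add: L_def algebra_simps)
qed

text \<open>Class numbers count bits, whereas \<open>weight_words\<close> counts digits to base
  \<open>n\<close>; writing \<open>n\<close> as a power of 2 costs one more logarithm.\<close>

lemma weight_class_bound:
  assumes n: "n \<ge> 2" and W: "real W \<le> real n powr (b * log 2 (real n) ^ a)"
  shows "real (Suc (weight_class W)) \<le> (2 + \<bar>b\<bar>) * log 2 (real n) ^ (a + 1)"
proof -
  define L where "L = log 2 (real n)"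
  have L: "L \<ge> 1" using n by (simp add: L_def)
  have La: "L ^ (a + 1) \<ge> 1" using L by (intro one_le_power)
  let ?x = "\<bar>b\<bar> * L ^ (a + 1)"
  have x0: "?x \<ge> 0" using L by simp
  have n2: "real n = 2 powr L" using n by (simp add: L_def)
  have "real W \<le> 2 powr ?x"
  proof -
    have "real W \<le> (2 powr L) powr (b * L ^ a)" 
      using W[folded L_def] unfolding n2[symmetric] .
    also have "\<dots> = 2 powr (b * L ^ (a + 1))" by (simp add: powr_powr algebra_simps)
    also have "\<dots> \<le> 2 powr ?x"
    proof (rule powr_mono)
      show "b * L ^ (a + 1) \<le> ?x" using La by (intro mult_right_mono) auto
    qed simp
    finally show ?thesis .
  qed
  then have "real W < 2 ^ (nat \<lfloor>?x\<rfloor> + 1)" using x0 by (intro less_power_floor) auto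
  then have "W < 2 ^ (nat \<lfloor>?x\<rfloor> + 1)" by (metis of_nat_less_iff of_nat_numeral of_nat_power)
  then have "weight_class W \<le> nat \<lfloor>?x\<rfloor> + 1" by (rule weight_class_le)
  then have "real (weight_class W) \<le> ?x + 1" using x0 by linarith
  then have "real (Suc (weight_class W)) \<le> 2 * 1 + ?x" by simp
  also have "\<dots> \<le> 2 * L ^ (a + 1) + ?x" using La by linarith
  finally show ?thesis by (simp add: L_def algebra_simps)
qed

text \<open>The exponent collects \<open>a\<close> for the words per edge, \<open>a + 1\<close> for
  the number of weight classes and 1 for \<open>t\<close>. The constant 64 is the 8 of the bound for
  one class times the 8 in \<open>(8 * t) powr (1 - 1 / t) \<le> 8 * t\<close>, where
  \<open>8 * t\<close> stems from packings of size 2k with \<open>2 * t\<close> vertices per path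
  and the doubling in the sample size.\<close>

lemma elc_algorithm_memory_bound:
  assumes n: "n \<ge> 2" and W: "real W \<le> real n powr (b * log 2 (real n) ^ a)"
    and t: "t \<ge> 1" "real t \<le> c * log 2 (real n)"
    and xs: "distinct (map fst xs)" "set xs \<subseteq> stream_items n W"
  shows "real (length (memory_after (elc_algorithm n R r W t) xs))
    \<le> 64 * (3 + \<bar>b\<bar>) * (2 + \<bar>b\<bar>) * c * log 2 (real n) ^ (2 * a + 2)
      * (real (max_requirement R r) powr (1 - 1 / real t) * real n powr (1 + 1 / real t))"
proof -
  define k where "k = max_requirement R r"
  define L where "L = log 2 (real n)"
  define s where "s = greedy (2 * k) t xs"
  have sI: "set s \<subseteq> stream_items n W" using xs(2) set_greedy_subset unfolding s_def by blast
  have mem: "memory_after (elc_algorithm n R r W t) xs = encode n W s"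
    using memory_after_elc_algorithm[OF n xs(2)] by (simp add: s_def k_def)
  have xsV: "fst ` set xs \<subseteq> [{..<n}]\<^bsup>2\<^esup>" using xs(2) by (auto simp: stream_items_def)
  show ?thesis
  proof (cases "k = 0")
    case True
    then have "s = []" using greedy_no_paths[of xs "{..<n}" t] xsV unfolding s_def by auto
    then show ?thesis using mem True by (simp add: encode_def k_def)
  next
    case False
    define X where "X = real k powr (1 - 1 / real t) * real n powr (1 + 1 / real t)"
    have X0: "X \<ge> 0" by (simp add: X_def)
    have L1: "L \<ge> 1" using n by (simp add: L_def)
    have "(2 * real (2 * k * (2 * t))) powr (1 - 1 / real t)
        = (8 * real t) powr (1 - 1 / real t) * real k powr (1 - 1 / real t)"
      by (simp add: powr_mult[symmetric] algebra_simps)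
    also have "(8 * real t) powr (1 - 1 / real t) \<le> (8 * real t) powr 1"
      using t(1) by (intro powr_mono) auto
    finally have "(2 * real (2 * k * (2 * t))) powr (1 - 1 / real t) \<le> 8 * real t * real k powr (1 - 1 / real t)"
      by (simp add: mult_right_mono)
    then have "8 * (2 * real (2 * k * (2 * t))) powr (1 - 1 / real t) * real n powr (1 + 1 / real t)
        \<le> 8 * (8 * real t * real k powr (1 - 1 / real t)) * real n powr (1 + 1 / real t)"
      by (intro mult_right_mono mult_left_mono) auto
    also have "\<dots> = 64 * real t * X" by (simp add: X_def)
    also have "\<dots> \<le> 64 * (c * L) * X" using t(2) X0 by (intro mult_right_mono) (auto simp: L_def)
    finally have B: "8 * (2 * real (2 * k * (2 * t))) powr (1 - 1 / real t) * real n powr (1 + 1 / real t)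
        \<le> 64 * (c * L) * X" .
    have cL: "c * L \<ge> 0" using t by (simp add: L_def)
    have "real (length s) \<le> real (Suc (weight_class W)) *
        (8 * (2 * real (2 * k * (2 * t))) powr (1 - 1 / real t) * real n powr (1 + 1 / real t))"
      unfolding s_def using False xs(2)
      by (intro length_greedy_le[OF n t(1) _ xs(1) xsV]) (auto simp: stream_items_def)
    also have "\<dots> \<le> ((2 + \<bar>b\<bar>) * L ^ (a + 1)) * (64 * (c * L) * X)"
    proof (rule mult_mono[OF _ B])
      show "real (Suc (weight_class W)) \<le> (2 + \<bar>b\<bar>) * L ^ (a + 1)"
        using weight_class_bound[OF n W] by (simp only: L_def)
    qed (use L1 in simp_all)
    finally have ls: "real (length s) \<le> ((2 + \<bar>b\<bar>) * L ^ (a + 1)) * (64 * (c * L) * X)" .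
    have "real (length (encode n W s)) = real (2 + weight_words n W) * real (length s)"
      using length_encode[OF n sI] by (simp only: of_nat_mult)
    also have "\<dots> \<le> ((3 + \<bar>b\<bar>) * L ^ a) * (((2 + \<bar>b\<bar>) * L ^ (a + 1)) * (64 * (c * L) * X))"
    proof (rule mult_mono[OF _ ls])
      show "real (2 + weight_words n W) \<le> (3 + \<bar>b\<bar>) * L ^ a"
        using weight_words_le[OF n W] by (simp only: L_def)
    qed (use L1 in simp_all)
    also have "\<dots> = 64 * (3 + \<bar>b\<bar>) * (2 + \<bar>b\<bar>) * c * (L ^ a * L ^ (a + 1) * L) * X"
      by (simp only: mult_ac)
    also have "L ^ a * L ^ (a + 1) * L = L ^ (a + (a + 1) + 1)" by (simp only: power_add power_one_right)
    also have "a + (a + 1) + 1 = 2 * a + 2" by simp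
    finally show ?thesis using mem by (simp add: L_def X_def k_def)
  qed
qed

text \<open>The algorithm is fixed before the constants \<open>a\<close>, \<open>b\<close>,
  \<open>c\<close> of the standing assumptions, and \<open>C\<close>, \<open>d\<close> depend on
  these three only: this is the hidden polylogarithmic factor. The approximation is claimed for
  feasible instances, as \<open>elc_opt\<close> is otherwise a minimum of the empty set; word size
  and space are bounded on all instances.\<close>

theorem theorem3p8:
  "\<exists>A :: elc_streaming_algorithm.
     \<forall>(a::nat) (b::real) (c::real). \<exists>(C::real) (d::nat).
       \<forall>(n::nat) (W::nat) (t::nat) (R::nat set) (r::nat set \<Rightarrow> nat) (k::nat)
        (E::edge set) (w::edge \<Rightarrow> nat) (es::edge list).
         n \<ge> 2 \<longrightarrow>
         real W \<le> real n powr (b * log 2 (real n) ^ a) \<longrightarrow>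
         t \<ge> 1 \<longrightarrow> real t \<le> c * log 2 (real n) \<longrightarrow>
         R \<subseteq> {..<n} \<longrightarrow> k = max_requirement R r \<longrightarrow>
         E \<subseteq> [{..<n}]\<^bsup>2\<^esup> \<longrightarrow> w \<in> E \<rightarrow> {0..W} \<longrightarrow>
         distinct es \<longrightarrow> set es = E \<longrightarrow>
         (let alg = A n R r W t; stream = map (\<lambda>e. (e, w e)) es in
            uses_words n alg stream \<and>
            real (peak_space alg stream)
              \<le> C * log 2 (real n) ^ d
                  * (real k powr (1 - 1 / real t) * real n powr (1 + 1 / real t)) \<and>
            ((\<exists>F. elc_feasible E R r F) \<longrightarrow>
               elc_approximate (8 * real t) E w R r (output_on alg stream)))"
proof (intro exI[of _ elc_algorithm] allI)
  fix a :: nat and b c :: real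
  show "\<exists>(C::real) (d::nat).
       \<forall>(n::nat) (W::nat) (t::nat) (R::nat set) (r::nat set \<Rightarrow> nat) (k::nat)
        (E::edge set) (w::edge \<Rightarrow> nat) (es::edge list).
         n \<ge> 2 \<longrightarrow>
         real W \<le> real n powr (b * log 2 (real n) ^ a) \<longrightarrow>
         t \<ge> 1 \<longrightarrow> real t \<le> c * log 2 (real n) \<longrightarrow>
         R \<subseteq> {..<n} \<longrightarrow> k = max_requirement R r \<longrightarrow>
         E \<subseteq> [{..<n}]\<^bsup>2\<^esup> \<longrightarrow> w \<in> E \<rightarrow> {0..W} \<longrightarrow>
         distinct es \<longrightarrow> set es = E \<longrightarrow>
         (let alg = elc_algorithm n R r W t; stream = map (\<lambda>e. (e, w e)) es in
            uses_words n alg stream \<and>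
            real (peak_space alg stream)
              \<le> C * log 2 (real n) ^ d
                  * (real k powr (1 - 1 / real t) * real n powr (1 + 1 / real t)) \<and>
            ((\<exists>F. elc_feasible E R r F) \<longrightarrow>
               elc_approximate (8 * real t) E w R r (output_on alg stream)))"
  proof (intro exI[of _ "64 * (3 + \<bar>b\<bar>) * (2 + \<bar>b\<bar>) * c"] exI[of _ "2 * a + 2"] allI impI, unfold Let_def,
      intro conjI impI)
    fix n W t :: nat and R r k and E :: "edge set" and w es
    assume n: "n \<ge> 2" and W: "real W \<le> real n powr (b * log 2 (real n) ^ a)"
      and t: "t \<ge> 1" "real t \<le> c * log 2 (real n)" and R: "R \<subseteq> {..<n}"
      and k: "k = max_requirement R r" and E: "E \<subseteq> [{..<n}]\<^bsup>2\<^esup>" and w: "w \<in> E \<rightarrow> {0..W}"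
      and es: "distinct es" "set es = E"
    let ?alg = "elc_algorithm n R r W t" and ?stream = "map (\<lambda>e. (e, w e)) es"
    have str: "set (take i ?stream) \<subseteq> stream_items n W" for i
      using E w es(2) by (auto simp: stream_items_def Pi_def dest!: in_set_takeD)
    have dis: "distinct (map fst (take i ?stream))" for i
      using es(1) by (simp add: take_map[symmetric] comp_def)
    show "uses_words n ?alg ?stream"
      unfolding uses_words_def
    proof (intro allI impI)
      fix i
      have "set (greedy (2 * max_requirement R r) t (take i ?stream)) \<subseteq> stream_items n W"
        using str[of i] set_greedy_subset by blast
      then show "set (memory_after ?alg (take i ?stream)) \<subseteq> {..<n}"
        unfolding memory_after_elc_algorithm[OF n str] by (rule set_encode[OF n])
    qed
    \<comment> \<open>The peak is attained after some prefix, and a prefix is itself a stream of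
      distinct edges, so the memory bound applies to it.\<close>
    have "peak_space ?alg ?stream \<in> (\<lambda>i. length (memory_after ?alg (take i ?stream))) ` {..length ?stream}"
      unfolding peak_space_def by (intro Max_in) auto
    then obtain i where "peak_space ?alg ?stream = length (memory_after ?alg (take i ?stream))" by blast
    then show "real (peak_space ?alg ?stream)
        \<le> 64 * (3 + \<bar>b\<bar>) * (2 + \<bar>b\<bar>) * c * log 2 (real n) ^ (2 * a + 2)
          * (real k powr (1 - 1 / real t) * real n powr (1 + 1 / real t))"
      using elc_algorithm_memory_bound[OF n W t dis[of i] str[of i], of R r] k by simp
    assume "\<exists>F. elc_feasible E R r F"
    then show "elc_approximate (8 * real t) E w R r (output_on ?alg ?stream)"
      by (rule elc_algorithm_approximates[OF n R E w es t(1)])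
  qed
qed

end
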